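(* For $2\le k<n$, every (possibly randomized) online algorithm for Caching in Matchings (on bipartite graphs with $n$ nodes per side and $k$ matchings) has competitive ratio $\Omega\!\left(\log\frac{n}{k^2\log k}\cdot\log k\right)$.
   Context: Caching in Matchings (bipartite version): there are two disjoint node sets $V^{in}$ and $V^{out}$, each of size $n$. Requests arrive online, each being an edge $(u,v)\in V^{in}\times V^{out}$. The algorithm maintains a cache $M$ which is the union of $k$ matchings (a properly $k$-edge-colored set of edges). If a requested edge is in none of the matchings, the algorithm must insert it into one of the matchings, evicting from that matching the edges incident to its endpoints. The algorithm may add any edge to any matching at any time (keeping each a matching) and may evict freely; each addition of an edge to a matching costs $1$ (so recoloring an edge costs $1$). A randomized online algorithm $A$ is $c$-competitive if there is $d=d(n,k)$ with $\mathbb{E}[\mathrm{cost}(A(\sigma))]\le c\cdot\mathrm{cost}(OPT(\sigma))+d$ for every request sequence $\sigma$ (oblivious adversary), where $OPT$ is the optimal offline cost with $k$ matchings. Logarithms are base $2$. *)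

theory Defs
  imports "HOL-Probability.Probability"
begin

text \<open>
  Nodes on either side are named by \<open>{..<n}\<close>; the component of the pair tells the side, so the
  two node sets are disjoint even though the indices coincide.
\<close>

type_synonym edge = "nat \<times> nat"

definition edges :: "nat \<Rightarrow> edge set" where
  "edges n = {..<n} \<times> {..<n}"

text \<open>Injectivity of the projections: distinct edges share neither endpoint.\<close>

definition matching :: "edge set \<Rightarrow> bool" where
  "matching M \<longleftrightarrow> inj_on fst M \<and> inj_on snd M"

text \<open>
  A cache is the list of its \<open>k\<close> colour classes. They are pairwise disjoint, since in an
  edge-coloured set every edge carries exactly one colour.
\<close>

type_synonym cache = "edge set list"

definition is_cache :: "nat \<Rightarrow> nat \<Rightarrow> cache \<Rightarrow> bool" where
  "is_cache n k C \<longleftrightarrow>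
     length C = k \<and>
     (\<forall>i<k. C ! i \<subseteq> edges n \<and> matching (C ! i)) \<and>
     (\<forall>i<k. \<forall>j<k. i \<noteq> j \<longrightarrow> C ! i \<inter> C ! j = {})"

definition cached :: "cache \<Rightarrow> edge set" where
  "cached C = \<Union>(set C)"

text \<open>
  Evictions are free; an edge that changes its colour is an addition to its new matching.
\<close>

definition step_cost :: "nat \<Rightarrow> cache \<Rightarrow> cache \<Rightarrow> nat" where
  "step_cost k C C' = (\<Sum>i<k. card (C' ! i - C ! i))"

text \<open>
  \<open>S t\<close> is the cache after the first \<open>t\<close> requests have been served. Between two consecutive
  caches arbitrarily many edges may be added and evicted.
\<close>

definition feasible :: "nat \<Rightarrow> nat \<Rightarrow> edge list \<Rightarrow> (nat \<Rightarrow> cache) \<Rightarrow> bool" where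
  "feasible n k \<sigma> S \<longleftrightarrow>
     S 0 = replicate k {} \<and>
     (\<forall>t\<le>length \<sigma>. is_cache n k (S t)) \<and>
     (\<forall>t<length \<sigma>. \<sigma> ! t \<notin> cached (S t) \<longrightarrow> \<sigma> ! t \<in> cached (S (Suc t)))"

definition schedule_cost :: "nat \<Rightarrow> edge list \<Rightarrow> (nat \<Rightarrow> cache) \<Rightarrow> nat" where
  "schedule_cost k \<sigma> S = (\<Sum>t<length \<sigma>. step_cost k (S t) (S (Suc t)))"

text \<open>
  For \<open>k \<ge> 1\<close> and \<open>\<sigma> \<in> lists (edges n)\<close> there are feasible schedules (keep just the requested
  edge), so the infimum is attained.
\<close>

definition opt_cost :: "nat \<Rightarrow> nat \<Rightarrow> edge list \<Rightarrow> nat" where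
  "opt_cost n k \<sigma> = Inf {schedule_cost k \<sigma> S | S. feasible n k \<sigma> S}"

text \<open>
  A deterministic online algorithm maps the requests seen so far to the cache held after
  serving them.
\<close>

type_synonym det_alg = "edge list \<Rightarrow> cache"

definition run :: "det_alg \<Rightarrow> edge list \<Rightarrow> nat \<Rightarrow> cache" where
  "run A \<sigma> t = A (take t \<sigma>)"

definition det_online_alg :: "nat \<Rightarrow> nat \<Rightarrow> det_alg \<Rightarrow> bool" where
  "det_online_alg n k A \<longleftrightarrow> (\<forall>\<sigma>\<in>lists (edges n). feasible n k \<sigma> (run A \<sigma>))"

text \<open>
  A randomized online algorithm is a probability distribution on deterministic ones for which
  the cache after any request sequence is a random variable. Only finitely many caches occur
  for given \<open>n\<close> and \<open>k\<close>, hence the cost on each request sequence is bounded and measurable.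
\<close>

definition randomized_online_alg :: "nat \<Rightarrow> nat \<Rightarrow> det_alg measure \<Rightarrow> bool" where
  "randomized_online_alg n k D \<longleftrightarrow>
     prob_space D \<and>
     (\<forall>A\<in>space D. det_online_alg n k A) \<and>
     (\<forall>\<sigma>\<in>lists (edges n). (\<lambda>A. A \<sigma>) \<in> measurable D (count_space UNIV))"

definition expected_cost :: "nat \<Rightarrow> det_alg measure \<Rightarrow> edge list \<Rightarrow> real" where
  "expected_cost k D \<sigma> = (\<integral>A. real (schedule_cost k \<sigma> (run A \<sigma>)) \<partial>D)"

definition competitive :: "nat \<Rightarrow> nat \<Rightarrow> real \<Rightarrow> det_alg measure \<Rightarrow> bool" where
  "competitive n k c D \<longleftrightarrow>
     (\<exists>d. \<forall>\<sigma>\<in>lists (edges n). expected_cost k D \<sigma> \<le> c * real (opt_cost n k \<sigma>) + d)"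

text \<open>The ratio is \<open>\<infinity>\<close> for an algorithm that is not \<open>c\<close>-competitive for any \<open>c\<close>.\<close>

definition competitive_ratio :: "nat \<Rightarrow> nat \<Rightarrow> det_alg measure \<Rightarrow> ereal" where
  "competitive_ratio n k D = (INF c\<in>{c. competitive n k c D}. ereal c)"

end

theory Submission
  imports Defs
begin

text \<open>
  A gadget is a \<open>k\<close>-regular bipartite graph minus one edge. In a proper colouring with \<open>k\<close> colours
  the two endpoints of the missing edge miss the same colour, so a gadget carries one colour, and
  links between gadgets or common neighbours (hubs) of gadgets force equal or distinct colours. Linked
  gadgets form strands, and a bundle consists of about \<open>k\<close> strands of distinct colours.

  The adversary merges bundles pairwise over about \<open>log (n / (k\<^sup>2 log k))\<close> levels. Strand \<open>j\<close> of one
  bundle is to be linked with strand \<open>j XOR y\<close> of the other. The \<open>\<Theta>(log k)\<close> bits of \<open>y\<close>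
  are revealed one by one through hubs that forbid the equality of colours of strands whose labels
  disagree in the bit. Whatever the current colouring is, for one of the two values of the bit a
  constant fraction of all gadgets has to be recoloured, and the adversary picks the value
  that is worse in expectation. Repeating every stage many times forces the algorithm to hold all its
  edges at once. An offline schedule knows all \<open>y\<close> of a phase in advance and recolours every gadget only
  once per phase, at constant cost per gadget.
\<close>

text \<open>The shape of the bound is a node count. A gadget has \<open>2 ^ r <= 2 * k\<close> nodes
  per side, so \<open>2 ^ J\<close> bundles of \<open>K <= k\<close> gadgets take about
  \<open>2 * k\<^sup>2 * 2 ^ J\<close> nodes. At level \<open>s\<close> the offline schedule buys up
  to \<open>2 ^ (J - s) * K\<close> hub edges for each of the \<open>l\<close> bits, which is a
  constant per gadget only once \<open>2 ^ s\<close> reaches \<open>l\<close>. So about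
  \<open>log l\<close> levels yield nothing, and with \<open>l\<close> of order \<open>log k\<close>
  the remaining \<open>J - s0\<close> are of order \<open>log (n / (k\<^sup>2 log k))\<close>. A
  test is expensive online because colours are constant along a path: separating two strands
  recolours every gadget of one of them, however long the paths are. XOR suits the relation because
  its bits can be revealed independently and because later merges shift all labels of a merged block
  alike. What earlier levels demand is therefore preserved, and the final labels serve as one
  colouring for the whole phase. Labels have to stay below \<open>K\<close> under XOR with
  \<open>y < 2 ^ l\<close>, so \<open>K\<close> is a multiple of \<open>2 ^ l\<close>; and
  \<open>2 * k <= 3 * K\<close> keeps the colour overlap \<open>2 * K - k\<close> of two bundles at
  least \<open>K / 2\<close>.\<close>

lemma finite_edges [simp]: "finite (edges n)"
  by (simp add: edges_def)

section \<open>Costs of schedules and repeated blocks of requests\<close>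

lemma is_cache_nth_finite: "is_cache n k C \<Longrightarrow> i < k \<Longrightarrow> finite (C ! i)"
  by (rule finite_subset[of _ "edges n"]) (simp_all add: is_cache_def)

lemma is_cache_empty: "is_cache n k (replicate k {})"
  by (auto simp: is_cache_def matching_def)

lemma mem_cached_iff: "is_cache n k C \<Longrightarrow> e \<in> cached C \<longleftrightarrow> (\<exists>i<k. e \<in> C ! i)"
  unfolding is_cache_def cached_def by (metis Union_iff in_set_conv_nth)

lemma step_cost_refl [simp]: "step_cost k C C = 0"
  by (simp add: step_cost_def)

lemma step_cost_triangle:
  assumes "is_cache n k C'" "is_cache n k C''"
  shows "step_cost k C C'' \<le> step_cost k C C' + step_cost k C' C''"
  unfolding step_cost_def sum.distrib[symmetric]
proof (rule sum_mono)
  fix i assume "i \<in> {..<k}"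
  then have "finite (C' ! i)" "finite (C'' ! i)"
    using assms is_cache_nth_finite by auto
  then have "card (C'' ! i - C ! i) \<le> card ((C' ! i - C ! i) \<union> (C'' ! i - C' ! i))"
    by (intro card_mono) auto
  also have "\<dots> \<le> card (C' ! i - C ! i) + card (C'' ! i - C' ! i)"
    by (rule card_Un_le)
  finally show "card (C'' ! i - C ! i) \<le> card (C' ! i - C ! i) + card (C'' ! i - C' ! i)" .
qed

definition segment_cost :: "nat \<Rightarrow> (nat \<Rightarrow> cache) \<Rightarrow> nat \<Rightarrow> nat \<Rightarrow> nat" where
  "segment_cost k S a b = (\<Sum>t\<in>{a..<b}. step_cost k (S t) (S (Suc t)))"

lemma segment_cost_append:
  "a \<le> b \<Longrightarrow> b \<le> c \<Longrightarrow> segment_cost k S a c = segment_cost k S a b + segment_cost k S b c"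
  unfolding segment_cost_def by (simp add: sum.atLeastLessThan_concat)

lemma segment_cost_mono:
  "a' \<le> a \<Longrightarrow> b \<le> b' \<Longrightarrow> segment_cost k S a b \<le> segment_cost k S a' b'"
  unfolding segment_cost_def by (rule sum_mono2) auto

lemma schedule_cost_eq_segment: "schedule_cost k \<sigma> S = segment_cost k S 0 (length \<sigma>)"
  by (simp add: schedule_cost_def segment_cost_def lessThan_atLeast0)

lemma step_cost_le_segment_cost:
  assumes "a \<le> b" "\<And>t. t \<le> b \<Longrightarrow> is_cache n k (S t)"
  shows "step_cost k (S a) (S b) \<le> segment_cost k S a b"
  using assms
proof (induction b rule: dec_induct)
  case base
  show ?case by (simp add: segment_cost_def)
next
  case (step b)
  have "step_cost k (S a) (S (Suc b)) \<le> step_cost k (S a) (S b) + step_cost k (S b) (S (Suc b))"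
    using step.prems by (intro step_cost_triangle[of n]) auto
  also have "\<dots> \<le> segment_cost k S a b + step_cost k (S b) (S (Suc b))"
    using step by auto
  also have "\<dots> = segment_cost k S a (Suc b)"
    using step.hyps by (simp add: segment_cost_def)
  finally show ?case .
qed

lemma cached_subset_if_free:
  assumes "is_cache n k C" "is_cache n k C'" "step_cost k C C' = 0"
  shows "cached C' \<subseteq> cached C"
proof
  fix e assume "e \<in> cached C'"
  then obtain i where i: "i < k" "e \<in> C' ! i"
    using mem_cached_iff[OF assms(2)] by auto
  have "card (C' ! i - C ! i) = 0"
    using assms(3) i by (simp add: step_cost_def)
  then have "C' ! i \<subseteq> C ! i"
    using is_cache_nth_finite[OF assms(2)] i by simp
  then show "e \<in> cached C"
    using i mem_cached_iff[OF assms(1)] by auto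
qed

lemma cached_antimono_if_free:
  assumes "a \<le> t" "t \<le> b" "\<And>t. t \<le> b \<Longrightarrow> is_cache n k (S t)" "segment_cost k S a b = 0"
  shows "cached (S t) \<subseteq> cached (S a)"
  using assms(1,2)
proof (induction t rule: dec_induct)
  case (step t)
  have "step_cost k (S t) (S (Suc t)) = 0"
    using assms(4) step by (simp add: segment_cost_def)
  then have "cached (S (Suc t)) \<subseteq> cached (S t)"
    using step.prems assms(3) by (intro cached_subset_if_free[of n k]) auto
  then show ?case using step by auto
qed simp

text \<open>Without additions the cached set only shrinks, so an edge that is present at or just
  after its request was present at time \<open>a\<close> already.\<close>

lemma cached_if_free:
  assumes "feasible n k \<sigma> S" "a + length es \<le> length \<sigma>"
    and "\<And>i. i < length es \<Longrightarrow> \<sigma> ! (a + i) = es ! i"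
    and "segment_cost k S a (a + length es) = 0"
  shows "set es \<subseteq> cached (S a)"
proof
  fix e assume "e \<in> set es"
  then obtain i where i: "i < length es" "e = es ! i"
    by (auto simp: in_set_conv_nth)
  have "a + i < length \<sigma>" "\<sigma> ! (a + i) = e"
    using assms(2,3) i by auto
  then have "e \<in> cached (S (a + i)) \<or> e \<in> cached (S (Suc (a + i)))"
    using assms(1) unfolding feasible_def by blast
  moreover have "cached (S t) \<subseteq> cached (S a)" if "a \<le> t" "t \<le> a + length es" for t
    using assms that by (intro cached_antimono_if_free[of _ _ "a + length es" n]) (auto simp: feasible_def)
  moreover from calculation(2) i have "cached (S (a + i)) \<subseteq> cached (S a)" "cached (S (Suc (a + i))) \<subseteq> cached (S a)"
    by simp_all
  ultimately show "e \<in> cached (S a)"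
    by blast
qed

lemma nth_concat_replicate:
  "i < m \<Longrightarrow> j < length es \<Longrightarrow> concat (replicate m es) ! (i * length es + j) = es ! j"
proof (induction m arbitrary: i)
  case (Suc m)
  show ?case
  proof (cases i)
    case 0
    then show ?thesis using Suc.prems by (simp add: nth_append)
  next
    case (Suc i')
    then show ?thesis using Suc.IH[of i'] Suc.prems
      by (simp add: nth_append add.assoc)
  qed
qed simp

lemma length_concat_replicate: "length (concat (replicate m es)) = m * length es"
  by (induction m) auto

text \<open>Each of the \<open>m\<close> passes over \<open>es\<close> either costs at least 1 or is
  free, and at the start of a free pass all of \<open>es\<close> is cached by
  \<open>cached_if_free\<close>.\<close>

lemma repeated_block:
  assumes "feasible n k (\<sigma> @ concat (replicate m es) @ \<tau>) S"
  shows "m \<le> segment_cost k S (length \<sigma>) (length \<sigma> + m * length es) \<or>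
    (\<exists>a. length \<sigma> \<le> a \<and> a \<le> length \<sigma> + m * length es \<and> set es \<subseteq> cached (S a))"
proof -
  have "i \<le> m \<Longrightarrow> i \<le> segment_cost k S (length \<sigma>) (length \<sigma> + i * length es) \<or>
    (\<exists>a. length \<sigma> \<le> a \<and> a \<le> length \<sigma> + m * length es \<and> set es \<subseteq> cached (S a))" for i
  proof (induction i)
    case (Suc i)
    let ?a = "length \<sigma> + i * length es"
    have le: "?a + length es \<le> length \<sigma> + m * length es"
      using Suc.prems mult_le_mono1[of "Suc i" m "length es"] by simp
    show ?case
    proof (cases "segment_cost k S ?a (?a + length es) = 0")
      case True
      have "set es \<subseteq> cached (S ?a)"
      proof (rule cached_if_free[OF assms _ _ True])
        show "?a + length es \<le> length (\<sigma> @ concat (replicate m es) @ \<tau>)"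
          using le by (simp add: length_concat_replicate)
        fix j assume "j < length es"
        then show "(\<sigma> @ concat (replicate m es) @ \<tau>) ! (?a + j) = es ! j"
          using nth_concat_replicate[of i m j es] Suc.prems le
          by (simp add: nth_append length_concat_replicate add.assoc)
      qed
      moreover have "?a \<le> length \<sigma> + m * length es" using le by linarith
      ultimately show ?thesis by (intro disjI2 exI[of _ ?a]) auto
    next
      case False
      have "segment_cost k S (length \<sigma>) (length \<sigma> + Suc i * length es)
          = segment_cost k S (length \<sigma>) ?a + segment_cost k S ?a (?a + length es)"
        by (subst segment_cost_append[of _ ?a]) (auto simp: algebra_simps)
      then show ?thesis using Suc False by auto
    qed
  qed simp
  then show ?thesis by blast
qed

lemma segment_cost_cong:
  "(\<And>t. a \<le> t \<Longrightarrow> t \<le> b \<Longrightarrow> S t = S' t) \<Longrightarrow> segment_cost k S a b = segment_cost k S' a b"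
  unfolding segment_cost_def by (rule sum.cong) auto

abbreviation alg_cost :: "nat \<Rightarrow> det_alg \<Rightarrow> edge list \<Rightarrow> nat" where
  "alg_cost k A \<sigma> \<equiv> schedule_cost k \<sigma> (run A \<sigma>)"

lemma alg_cost_append:
  "alg_cost k A (\<sigma> @ \<tau>)
    = alg_cost k A \<sigma> + segment_cost k (run A (\<sigma> @ \<tau>)) (length \<sigma>) (length (\<sigma> @ \<tau>))"
proof -
  have "alg_cost k A (\<sigma> @ \<tau>) = segment_cost k (run A (\<sigma> @ \<tau>)) 0 (length \<sigma>)
      + segment_cost k (run A (\<sigma> @ \<tau>)) (length \<sigma>) (length (\<sigma> @ \<tau>))"
    unfolding schedule_cost_eq_segment by (rule segment_cost_append) auto
  moreover have "segment_cost k (run A (\<sigma> @ \<tau>)) 0 (length \<sigma>) = segment_cost k (run A \<sigma>) 0 (length \<sigma>)"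
    by (rule segment_cost_cong) (auto simp: run_def)
  ultimately show ?thesis by (simp add: schedule_cost_eq_segment)
qed

definition requests :: "nat \<Rightarrow> edge set \<Rightarrow> edge list" where
  "requests m E = concat (replicate m (SOME es. set es = E))"

lemma requests_block:
  assumes "finite E"
  obtains es where "set es = E" "requests m E = concat (replicate m es)"
proof -
  have "set (SOME es. set es = E) = E"
    using finite_list[OF assms] by (rule someI_ex)
  then show thesis using that by (simp add: requests_def)
qed

lemma set_requests_subset: "finite E \<Longrightarrow> set (requests m E) \<subseteq> E"
  by (rule requests_block[of E m]) (simp_all add: set_replicate_conv_if)

lemma requests_nonempty: "finite E \<Longrightarrow> E \<noteq> {} \<Longrightarrow> 0 < m \<Longrightarrow> requests m E \<noteq> []"
  by (rule requests_block[of E m]) (auto simp: concat_eq_Nil_conv)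

text \<open>The cache \<open>C\<close> below does not depend on the continuation, which is what lets the adversary
  play two continuations against the same cache.\<close>

lemma two_stage_cost:
  assumes A: "det_online_alg n k A" and \<sigma>: "\<sigma> \<in> lists (edges n)" and E: "E \<subseteq> edges n"
  shows "alg_cost k A \<sigma> + m \<le> alg_cost k A (\<sigma> @ requests m E) \<or>
    (\<exists>C. is_cache n k C \<and> E \<subseteq> cached C \<and>
      (\<forall>F\<subseteq>edges n. alg_cost k A \<sigma> + m \<le> alg_cost k A (\<sigma> @ requests m E @ requests m F) \<or>
        (\<exists>C'. is_cache n k C' \<and> F \<subseteq> cached C' \<and>
          alg_cost k A \<sigma> + step_cost k C C' \<le> alg_cost k A (\<sigma> @ requests m E @ requests m F))))"
proof -
  have finE: "finite E" using E by (rule finite_subset) simp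
  obtain es where es: "set es = E" "requests m E = concat (replicate m es)"
    by (rule requests_block[OF finE])
  let ?\<sigma>E = "\<sigma> @ requests m E"
  have \<sigma>E: "?\<sigma>E \<in> lists (edges n)"
    using \<sigma> set_requests_subset[OF finE] E by (auto simp: in_lists_conv_set)
  have feasE: "feasible n k ?\<sigma>E (run A ?\<sigma>E)"
    using A \<sigma>E by (auto simp: det_online_alg_def)
  have lenE: "length (requests m E) = m * length es"
    by (simp add: es length_concat_replicate)
  have "feasible n k (\<sigma> @ concat (replicate m es) @ []) (run A ?\<sigma>E)"
    using feasE by (simp only: es append_Nil2)
  note block = repeated_block[OF this]
  have "length ?\<sigma>E = length \<sigma> + m * length es"
    by (simp only: length_append lenE)
  with block es(1) consider "m \<le> segment_cost k (run A ?\<sigma>E) (length \<sigma>) (length ?\<sigma>E)"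
    | a where "length \<sigma> \<le> a" "a \<le> length ?\<sigma>E" "E \<subseteq> cached (run A ?\<sigma>E a)"
    by metis
  then show ?thesis
  proof cases
    case 1
    then show ?thesis using alg_cost_append[where k = k and A = A and \<sigma> = \<sigma> and \<tau> = "requests m E"] by linarith
  next
    case 2
    let ?C = "run A ?\<sigma>E a"
    have C: "is_cache n k ?C" using feasE 2 by (auto simp: feasible_def)
    have "alg_cost k A \<sigma> + m \<le> alg_cost k A (?\<sigma>E @ requests m F) \<or>
        (\<exists>C'. is_cache n k C' \<and> F \<subseteq> cached C' \<and>
          alg_cost k A \<sigma> + step_cost k ?C C' \<le> alg_cost k A (?\<sigma>E @ requests m F))"
      if F: "F \<subseteq> edges n" for F
    proof -
      have finF: "finite F" using F by (rule finite_subset) simp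
      obtain fs where fs: "set fs = F" "requests m F = concat (replicate m fs)"
        by (rule requests_block[OF finF])
      let ?\<sigma>F = "?\<sigma>E @ requests m F"
      have "?\<sigma>F \<in> lists (edges n)"
        using \<sigma>E set_requests_subset[OF finF] F by (auto simp: in_lists_conv_set)
      then have feasF: "feasible n k ?\<sigma>F (run A ?\<sigma>F)"
        using A by (auto simp: det_online_alg_def)
      have lenF: "length (requests m F) = m * length fs"
        by (simp add: fs length_concat_replicate)
      have cost: "alg_cost k A ?\<sigma>F
          = alg_cost k A \<sigma> + segment_cost k (run A ?\<sigma>F) (length \<sigma>) (length ?\<sigma>F)"
        using alg_cost_append[where k = k and A = A and \<sigma> = \<sigma> and \<tau> = "requests m E @ requests m F"] by simp
      have "feasible n k (?\<sigma>E @ concat (replicate m fs) @ []) (run A ?\<sigma>F)"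
        using feasF by (simp only: fs append_Nil2 append_assoc)
      note block = repeated_block[OF this]
      have "length ?\<sigma>F = length ?\<sigma>E + m * length fs"
        by (simp only: length_append lenF)
      with block fs(1) consider "m \<le> segment_cost k (run A ?\<sigma>F) (length ?\<sigma>E) (length ?\<sigma>F)"
        | a' where "length ?\<sigma>E \<le> a'" "a' \<le> length ?\<sigma>F" "F \<subseteq> cached (run A ?\<sigma>F a')"
        by metis
      then show ?thesis
      proof cases
        case 1
        also have "segment_cost k (run A ?\<sigma>F) (length ?\<sigma>E) (length ?\<sigma>F)
            \<le> segment_cost k (run A ?\<sigma>F) (length \<sigma>) (length ?\<sigma>F)"
          by (rule segment_cost_mono) auto
        finally show ?thesis using cost by linarith
      next
        case (2 a')
        \<comment> \<open>Time \<open>a\<close> lies in the common prefix, so an online algorithm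
          holds the same cache there whatever \<open>F\<close> is requested next.\<close>
        have "run A ?\<sigma>F a = ?C"
          using \<open>a \<le> length ?\<sigma>E\<close> by (simp add: run_def)
        then have "step_cost k ?C (run A ?\<sigma>F a') \<le> segment_cost k (run A ?\<sigma>F) a a'"
          using step_cost_le_segment_cost[of a a' n k "run A ?\<sigma>F"] feasF 2 \<open>a \<le> length ?\<sigma>E\<close>
          by (auto simp: feasible_def)
        also have "\<dots> \<le> segment_cost k (run A ?\<sigma>F) (length \<sigma>) (length ?\<sigma>F)"
          using 2 \<open>length \<sigma> \<le> a\<close> by (intro segment_cost_mono) auto
        finally show ?thesis using cost 2 feasF
          by (intro disjI2 exI[of _ "run A ?\<sigma>F a'"]) (auto simp: feasible_def)
      qed
    qed
    then show ?thesis using C 2 by (intro disjI2 exI[of _ ?C]) auto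
  qed
qed

section \<open>Gadgets\<close>

unbundle bit_operations_syntax

lemma xor_cancel [simp]:
  fixes x y :: nat
  shows "x XOR (x XOR y) = y" "(x XOR y) XOR y = x" "x XOR (y XOR x) = y" "(x XOR y) XOR x = y"
  by (metis xor.assoc xor.commute xor.left_neutral xor_self_eq)+

lemma xor_eq_iff [simp]:
  fixes x y z :: nat
  shows "x XOR y = x XOR z \<longleftrightarrow> y = z" "y XOR x = z XOR x \<longleftrightarrow> y = z"
  by (metis xor_cancel(1), metis xor_cancel(2))

lemma xor_eq_0_iff [simp]: "(x :: nat) XOR y = 0 \<longleftrightarrow> x = y"
  by (metis xor_eq_iff(1) xor_self_eq)

text \<open>XOR with \<open>y < 2 ^ l\<close> touches only the lowest \<open>l\<close> bits and
  leaves the quotient by \<open>2 ^ l\<close> alone.\<close>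

lemma xor_less_mult_power:
  fixes x y :: nat
  assumes "x < 2 ^ l * q" "y < 2 ^ l"
  shows "x XOR y < 2 ^ l * q"
proof -
  have "drop_bit l y = 0"
    using assms(2) by (simp add: drop_bit_eq_div)
  then have "drop_bit l (x XOR y) = drop_bit l x"
    by (simp only: drop_bit_xor xor.right_neutral)
  moreover have "x div 2 ^ l < q"
    using assms(1) by (simp add: less_mult_imp_div_less mult.commute)
  ultimately have "(x XOR y) div 2 ^ l < q"
    by (simp only: drop_bit_eq_div)
  then show ?thesis
    by (simp add: div_less_iff_less_mult mult.commute)
qed

lemma xor_less_power: "x < 2 ^ l \<Longrightarrow> y < 2 ^ l \<Longrightarrow> x XOR y < 2 ^ l" for x y :: nat
  using xor_less_mult_power[of x l 1 y] by simp

text \<open>A Cayley graph for XOR: row \<open>x\<close> is joined to the columns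
  \<open>x XOR d\<close> with \<open>d < k\<close>. For \<open>k <= 2 ^ r\<close> it is
  \<open>k\<close>-regular before the cell (0, 0) is removed, symmetric in rows and columns, and
  properly coloured by \<open>x XOR y\<close>.\<close>

definition cells :: "nat \<Rightarrow> nat \<Rightarrow> (nat \<times> nat) set" where
  "cells k r = {(x, y). x < 2 ^ r \<and> y < 2 ^ r \<and> x XOR y < k \<and> (x, y) \<noteq> (0, 0)}"

lemma cells_sym: "(x, y) \<in> cells k r \<longleftrightarrow> (y, x) \<in> cells k r"
  by (auto simp: cells_def xor.commute)

lemma finite_cells [simp]: "finite (cells k r)"
  by (rule finite_subset[of _ "{..<2 ^ r} \<times> {..<2 ^ r}"]) (auto simp: cells_def)

lemma cells_row:
  assumes "k \<le> 2 ^ r" "x < 2 ^ r"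
  shows "{y. (x, y) \<in> cells k r} = (\<lambda>d. x XOR d) ` ({..<k} - (if x = 0 then {0} else {}))"
proof (intro equalityI subsetI)
  fix y assume "y \<in> {y. (x, y) \<in> cells k r}"
  then have "x XOR y \<in> {..<k} - (if x = 0 then {0} else {})"
    by (auto simp: cells_def)
  then show "y \<in> (\<lambda>d. x XOR d) ` ({..<k} - (if x = 0 then {0} else {}))"
    by (rule rev_image_eqI) simp
next
  fix y assume "y \<in> (\<lambda>d. x XOR d) ` ({..<k} - (if x = 0 then {0} else {}))"
  then show "y \<in> {y. (x, y) \<in> cells k r}"
    using assms by (auto simp: cells_def intro!: xor_less_power split: if_splits)
qed

lemma card_cells_row:
  assumes "k \<le> 2 ^ r" "x < 2 ^ r" "0 < k"
  shows "card {y. (x, y) \<in> cells k r} = (if x = 0 then k - 1 else k)"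
  unfolding cells_row[OF assms(1,2)] using assms(3)
  by (subst card_image) (auto simp: inj_on_def card_Diff_singleton)

text \<open>Pigeonhole: the cells of a row have pairwise different colours out of \<open>k\<close>;
  row zero has \<open>k - 1\<close> cells and every other row has \<open>k\<close>.\<close>

lemma cells_rigid_row:
  fixes f :: "nat \<times> nat \<Rightarrow> nat"
  assumes k: "k \<le> 2 ^ r" "0 < k"
    and less: "\<And>e. e \<in> cells k r \<Longrightarrow> f e < k"
    and row: "\<And>x. inj_on (\<lambda>y. f (x, y)) {y. (x, y) \<in> cells k r}"
  shows "\<exists>!c. c < k \<and> (\<forall>y. (0, y) \<in> cells k r \<longrightarrow> f (0, y) \<noteq> c)"
    and "\<And>x c. 0 < x \<Longrightarrow> x < 2 ^ r \<Longrightarrow> c < k \<Longrightarrow> \<exists>y. (x, y) \<in> cells k r \<and> f (x, y) = c"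
proof -
  let ?row = "\<lambda>x. {y. (x, y) \<in> cells k r}"
  let ?im = "\<lambda>x. (\<lambda>y. f (x, y)) ` ?row x"
  have sub: "?im x \<subseteq> {..<k}" for x using less by auto
  have card: "card (?im x) = (if x = 0 then k - 1 else k)" if "x < 2 ^ r" for x
    using card_image[OF row] card_cells_row[OF k(1) that k(2)] by simp
  have "card ({..<k} - ?im 0) = 1"
    using card_Diff_subset[OF _ sub] sub[of 0] card[of 0] k by (simp add: finite_subset)
  then obtain c where c: "{..<k} - ?im 0 = {c}"
    by (auto simp: card_1_singleton_iff)
  then show "\<exists>!c. c < k \<and> (\<forall>y. (0, y) \<in> cells k r \<longrightarrow> f (0, y) \<noteq> c)"
    by (intro ex1I[of _ c]) (auto simp: set_eq_iff image_iff)
  show "\<exists>y. (x, y) \<in> cells k r \<and> f (x, y) = c" if "0 < x" "x < 2 ^ r" "c < k" for x c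
  proof -
    have "?im x = {..<k}"
      using card[of x] that sub by (intro card_subset_eq) auto
    with \<open>c < k\<close> have "c \<in> ?im x" by blast
    then show ?thesis by blast
  qed
qed

text \<open>A colour class covers all rows and columns except possibly the zeroth ones, and as many rows
  as columns; so it misses row zero iff it misses column zero.\<close>

lemma cells_rigid:
  fixes f :: "nat \<times> nat \<Rightarrow> nat"
  assumes k: "k \<le> 2 ^ r" "0 < k"
    and less: "\<And>e. e \<in> cells k r \<Longrightarrow> f e < k"
    and row: "\<And>x. inj_on (\<lambda>y. f (x, y)) {y. (x, y) \<in> cells k r}"
    and col: "\<And>y. inj_on (\<lambda>x. f (x, y)) {x. (x, y) \<in> cells k r}"
    and c: "c < k" "\<And>y. (0, y) \<in> cells k r \<Longrightarrow> f (0, y) \<noteq> c"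
  shows "(x, 0) \<in> cells k r \<Longrightarrow> f (x, 0) \<noteq> c"
proof
  assume x: "(x, 0) \<in> cells k r" "f (x, 0) = c"
  let ?M = "{e \<in> cells k r. f e = c}"
  have injs: "inj_on fst ?M" "inj_on snd ?M"
    using row col by (auto simp: inj_on_def)
  have "fst ` ?M \<subseteq> {1..<2 ^ r}"
  proof
    fix a assume "a \<in> fst ` ?M"
    then obtain b where b: "(a, b) \<in> cells k r" "f (a, b) = c" by auto
    with c(2) have "a \<noteq> 0" by metis
    with b show "a \<in> {1..<2 ^ r}" by (simp add: cells_def)
  qed
  then have "card ?M \<le> 2 ^ r - 1"
    using card_mono[of "{1..<2 ^ r}" "fst ` ?M"] card_image[OF injs(1)] by simp
  moreover have "{..<2 ^ r} \<subseteq> snd ` ?M"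
  proof
    fix y :: nat assume "y \<in> {..<2 ^ r}"
    show "y \<in> snd ` ?M"
    proof (cases "y = 0")
      case True
      then show ?thesis using x by force
    next
      case False
      \<comment> \<open>Every row but the zeroth uses all colours; transposing gives the same for
        columns.\<close>
      have "\<exists>x'. (y, x') \<in> cells k r \<and> f (x', y) = c"
        using cells_rigid_row(2)[OF k, of "\<lambda>(a, b). f (b, a)" y c] False \<open>y \<in> _\<close> less c(1) col
        by (auto simp: cells_sym[of _ _ k r])
      then show ?thesis by (force simp: cells_sym[of y])
    qed
  qed
  then have "2 ^ r \<le> card ?M"
    using card_mono[of "snd ` ?M" "{..<2 ^ r}"] card_image[OF injs(2)] by simp
  ultimately have "2 ^ r \<le> 2 ^ r - (1 :: nat)" by (rule order_trans[rotated])
  moreover have "0 < (2 :: nat) ^ r" by simp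
  ultimately show False by linarith
qed

definition gadget :: "nat \<Rightarrow> nat \<Rightarrow> nat \<Rightarrow> edge set" where
  "gadget k r g = (\<lambda>(x, y). (g * 2 ^ r + x, g * 2 ^ r + y)) ` cells k r"

lemma cell_mem_gadget [simp]: "(x, y) \<in> cells k r \<Longrightarrow> (g * 2 ^ r + x, g * 2 ^ r + y) \<in> gadget k r g"
  by (force simp: gadget_def)

lemma finite_gadget [simp]: "finite (gadget k r g)"
  by (simp add: gadget_def)

text \<open>Read off at the in-node of row zero only. By \<open>cells_rigid\<close> column zero
  misses the same colour, so an extra edge on either side determines it. For a cached gadget the
  description is unique.\<close>

definition free_colour :: "nat \<Rightarrow> nat \<Rightarrow> cache \<Rightarrow> nat \<Rightarrow> nat" where
  "free_colour k r C g =
    (THE c. c < k \<and> (\<forall>y. (0, y) \<in> cells k r \<longrightarrow> (g * 2 ^ r, g * 2 ^ r + y) \<notin> C ! c))"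

lemma cache_same_fst: "is_cache n k C \<Longrightarrow> c < k \<Longrightarrow> (a, b) \<in> C ! c \<Longrightarrow> (a, b') \<in> C ! c \<Longrightarrow> b = b'"
  unfolding is_cache_def matching_def inj_on_def by (metis prod.inject fst_conv)

lemma cache_same_snd: "is_cache n k C \<Longrightarrow> c < k \<Longrightarrow> (a, b) \<in> C ! c \<Longrightarrow> (a', b) \<in> C ! c \<Longrightarrow> a = a'"
  unfolding is_cache_def matching_def inj_on_def by (metis prod.inject snd_conv)

lemma cache_same_colour: "is_cache n k C \<Longrightarrow> c < k \<Longrightarrow> c' < k \<Longrightarrow> e \<in> C ! c \<Longrightarrow> e \<in> C ! c' \<Longrightarrow> c = c'"
  unfolding is_cache_def by (metis disjoint_iff)

context
  fixes n k r :: nat and C :: cache and g :: nat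
  assumes k: "k \<le> 2 ^ r" "0 < k" and cache: "is_cache n k C" and gadget: "gadget k r g \<subseteq> cached C"
begin

private definition "cell_colour = (\<lambda>(x, y). THE c. c < k \<and> (g * 2 ^ r + x, g * 2 ^ r + y) \<in> C ! c)"

private lemma cell_colour_eqI:
  "c < k \<Longrightarrow> (g * 2 ^ r + x, g * 2 ^ r + y) \<in> C ! c \<Longrightarrow> cell_colour (x, y) = c"
  unfolding cell_colour_def prod.case using cache_same_colour[OF cache] by (intro the_equality) auto

private lemma cell_colour:
  assumes "(x, y) \<in> cells k r"
  shows "cell_colour (x, y) < k" "(g * 2 ^ r + x, g * 2 ^ r + y) \<in> C ! cell_colour (x, y)"
proof -
  have "(g * 2 ^ r + x, g * 2 ^ r + y) \<in> cached C"
    using cell_mem_gadget[OF assms] gadget by blast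
  then obtain c where "c < k" "(g * 2 ^ r + x, g * 2 ^ r + y) \<in> C ! c"
    using mem_cached_iff[OF cache] by blast
  then show "cell_colour (x, y) < k" "(g * 2 ^ r + x, g * 2 ^ r + y) \<in> C ! cell_colour (x, y)"
    using cell_colour_eqI by auto
qed

private lemma cell_colour_row: "inj_on (\<lambda>y. cell_colour (x, y)) {y. (x, y) \<in> cells k r}"
proof (rule inj_onI, clarify)
  fix y y' assume "(x, y) \<in> cells k r" "(x, y') \<in> cells k r" "cell_colour (x, y) = cell_colour (x, y')"
  then have "g * 2 ^ r + y = g * 2 ^ r + y'"
    using cell_colour[of x y] cell_colour[of x y'] by (intro cache_same_fst[OF cache]) auto
  then show "y = y'" by simp
qed

private lemma cell_colour_col: "inj_on (\<lambda>x. cell_colour (x, y)) {x. (x, y) \<in> cells k r}"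
proof (rule inj_onI, clarify)
  fix x x' assume "(x, y) \<in> cells k r" "(x', y) \<in> cells k r" "cell_colour (x, y) = cell_colour (x', y)"
  then have "g * 2 ^ r + x = g * 2 ^ r + x'"
    using cell_colour[of x y] cell_colour[of x' y] by (intro cache_same_snd[OF cache]) auto
  then show "x = x'" by simp
qed

private lemma free_iff:
  "c < k \<Longrightarrow> (\<forall>y. (0, y) \<in> cells k r \<longrightarrow> cell_colour (0, y) \<noteq> c) \<longleftrightarrow>
    (\<forall>y. (0, y) \<in> cells k r \<longrightarrow> (g * 2 ^ r, g * 2 ^ r + y) \<notin> C ! c)"
  using cell_colour(2)[of 0] cell_colour_eqI[of c 0] by (metis add_0_right)

private lemma ex1_free:
  "\<exists>!c. c < k \<and> (\<forall>y. (0, y) \<in> cells k r \<longrightarrow> (g * 2 ^ r, g * 2 ^ r + y) \<notin> C ! c)"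
proof -
  have "\<exists>!c. c < k \<and> (\<forall>y. (0, y) \<in> cells k r \<longrightarrow> cell_colour (0, y) \<noteq> c)"
    using cell_colour cell_colour_row by (intro cells_rigid_row(1)[OF k]) auto
  then show ?thesis using free_iff by (simp cong: conj_cong)
qed

lemma free_colour_less: "free_colour k r C g < k"
  and free_colour_row: "(0, y) \<in> cells k r \<Longrightarrow> (g * 2 ^ r, g * 2 ^ r + y) \<notin> C ! free_colour k r C g"
  using theI'[OF ex1_free] by (auto simp: free_colour_def)

lemma free_colour_eqI:
  "c < k \<Longrightarrow> (\<And>y. (0, y) \<in> cells k r \<Longrightarrow> (g * 2 ^ r, g * 2 ^ r + y) \<notin> C ! c) \<Longrightarrow> free_colour k r C g = c"
  unfolding free_colour_def by (rule the1_equality[OF ex1_free]) auto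

lemma free_colour_eqI':
  assumes c: "c < k" "\<And>x. (x, 0) \<in> cells k r \<Longrightarrow> (g * 2 ^ r + x, g * 2 ^ r) \<notin> C ! c"
  shows "free_colour k r C g = c"
proof (rule free_colour_eqI[OF c(1)])
  fix y assume y: "(0, y) \<in> cells k r"
  have "(\<lambda>(a, b). cell_colour (b, a)) (y, 0) \<noteq> c"
  proof (rule cells_rigid[OF k])
    show "(case e of (a, b) \<Rightarrow> cell_colour (b, a)) < k" if "e \<in> cells k r" for e
      using that cell_colour(1) cells_sym by (cases e) simp
    show "(case (0, x) of (a, b) \<Rightarrow> cell_colour (b, a)) \<noteq> c" if "(0, x) \<in> cells k r" for x
      using that cell_colour(2)[of x 0] c(2)[of x] cells_sym[of x 0] by auto
    show "(y, 0) \<in> cells k r" using y cells_sym by simp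
  qed (use c(1) cell_colour_row cell_colour_col in \<open>simp_all add: cells_sym[of _ _ k r]\<close>)
  then show "(g * 2 ^ r, g * 2 ^ r + y) \<notin> C ! c"
    using cell_colour_eqI[of c 0 y] c(1) by auto
qed

text \<open>The colour class of the extra edge contains no other edge at its in-node, so its colour
  is the one that row zero misses.\<close>

lemma free_colour_eq_out:
  assumes "c < k" "(g * 2 ^ r, b) \<in> C ! c" "(g * 2 ^ r, b) \<notin> gadget k r g"
  shows "free_colour k r C g = c"
proof (rule free_colour_eqI[OF assms(1)])
  fix y assume "(0, y) \<in> cells k r"
  then show "(g * 2 ^ r, g * 2 ^ r + y) \<notin> C ! c"
    using cache_same_fst[OF cache assms(1,2)] assms(3) cell_mem_gadget[of 0 y k r g] by auto
qed

lemma free_colour_eq_in: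
  assumes "c < k" "(a, g * 2 ^ r) \<in> C ! c" "(a, g * 2 ^ r) \<notin> gadget k r g"
  shows "free_colour k r C g = c"
proof (rule free_colour_eqI'[OF assms(1)])
  fix x assume "(x, 0) \<in> cells k r"
  then show "(g * 2 ^ r + x, g * 2 ^ r) \<notin> C ! c"
    using cache_same_snd[OF cache assms(1,2)] assms(3) cell_mem_gadget[of x 0 k r g] by auto
qed

end

text \<open>If the colour free in \<open>C'\<close> was not free in \<open>C\<close>, then
  \<open>C\<close> used it on an edge of row zero, and \<open>C'\<close> holds that edge in another
  class: an addition. The in-node of the edge tells the gadget, so no addition is charged
  twice.\<close>

lemma step_cost_ge_recoloured:
  assumes k: "k \<le> 2 ^ r" "0 < k" and C: "is_cache n k C" and C': "is_cache n k C'"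
    and G: "\<And>g. g \<in> G \<Longrightarrow> gadget k r g \<subseteq> cached C \<and> gadget k r g \<subseteq> cached C'"
  shows "card {g \<in> G. free_colour k r C g \<noteq> free_colour k r C' g} \<le> step_cost k C C'"
proof -
  let ?D = "SIGMA c:{..<k}. C' ! c - C ! c"
  have "{g \<in> G. free_colour k r C g \<noteq> free_colour k r C' g} \<subseteq> (\<lambda>(c, e). fst e div 2 ^ r) ` ?D"
  proof (rule subsetI, clarify)
    fix g assume g: "g \<in> G" "free_colour k r C g \<noteq> free_colour k r C' g"
    define c where "c = free_colour k r C' g"
    have c: "c < k"
      unfolding c_def using free_colour_less[OF k C'] G[OF g(1)] by blast
    have "\<exists>y. (0, y) \<in> cells k r \<and> (g * 2 ^ r, g * 2 ^ r + y) \<in> C ! c"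
      using free_colour_eqI[OF k C _ c, of g] G[OF g(1)] g(2) c_def by metis
    then obtain y where y: "(0, y) \<in> cells k r" "(g * 2 ^ r, g * 2 ^ r + y) \<in> C ! c" by blast
    have "(g * 2 ^ r, g * 2 ^ r + y) \<in> cached C'"
      using G[OF g(1)] cell_mem_gadget[OF y(1), of g] by auto
    then obtain d where d: "d < k" "(g * 2 ^ r, g * 2 ^ r + y) \<in> C' ! d"
      using mem_cached_iff[OF C'] by blast
    have "d \<noteq> c"
      using free_colour_row[OF k C' _ y(1), of g] G[OF g(1)] d(2) c_def by auto
    then have "(g * 2 ^ r, g * 2 ^ r + y) \<notin> C ! d"
      using cache_same_colour[OF C d(1) c] y(2) by blast
    with d have "(d, (g * 2 ^ r, g * 2 ^ r + y)) \<in> ?D" by simp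
    then show "g \<in> (\<lambda>(c, e). fst e div 2 ^ r) ` ?D"
      by (rule rev_image_eqI) simp
  qed
  then have "card {g \<in> G. free_colour k r C g \<noteq> free_colour k r C' g} \<le> card ?D"
    by (rule surj_card_le[rotated]) (auto intro!: finite_SigmaI is_cache_nth_finite[OF C'])
  also have "card ?D = step_cost k C C'"
    by (simp add: step_cost_def is_cache_nth_finite[OF C'])
  finally show ?thesis .
qed

section \<open>Labels of strands\<close>

text \<open>
  The label of strand \<open>j\<close> of bundle \<open>p\<close> at level \<open>s\<close> is \<open>j XOR label_offset Y s p\<close>, where \<open>Y t\<close> is the
  relation chosen at level \<open>t\<close>.
\<close>

primrec label_offset :: "(nat \<Rightarrow> nat) \<Rightarrow> nat \<Rightarrow> nat \<Rightarrow> nat" where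
  "label_offset Y 0 p = 0"
| "label_offset Y (Suc s) p = label_offset Y s p XOR (if bit p s then Y s else 0)"

lemma label_offset_less: "(\<And>t. Y t < 2 ^ l) \<Longrightarrow> label_offset Y s p < 2 ^ l"
  by (induction s) (auto intro!: xor_less_power)

lemma label_offset_cong: "(\<And>t. t < s \<Longrightarrow> Y t = Y' t) \<Longrightarrow> label_offset Y s p = label_offset Y' s p"
  by (induction s) auto

lemma label_offset_cong_bits: "(\<And>t. t < s \<Longrightarrow> bit p t = bit p' t) \<Longrightarrow> label_offset Y s p = label_offset Y s p'"
  by (induction s) auto

lemma bit_eq_if_div_eq:
  fixes p p' :: nat
  assumes "p div 2 ^ s = p' div 2 ^ s" "s \<le> t"
  shows "bit p t = bit p' t"
proof -
  have "bit (drop_bit s p) (t - s) = bit (drop_bit s p') (t - s)"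
    using assms(1) by (simp only: drop_bit_eq_div)
  then show ?thesis using assms(2) by (simp add: bit_drop_bit_eq)
qed

text \<open>Levels from \<open>s\<close> on consult only the bits of \<open>p\<close> from
  \<open>s\<close> on, and these are shared by all bundles with the same
  \<open>p div 2 ^ s\<close>.\<close>

lemma label_offset_high:
  assumes "p div 2 ^ s = p' div 2 ^ s" "s \<le> u"
  shows "label_offset Y u p XOR label_offset Y s p = label_offset Y u p' XOR label_offset Y s p'"
  using assms(2)
proof (induction u rule: dec_induct)
  case (step u)
  have "bit p u = bit p' u"
    using bit_eq_if_div_eq[OF assms(1)] step.hyps by simp
  moreover have "label_offset Y (Suc u) q XOR label_offset Y s q
      = (label_offset Y u q XOR label_offset Y s q) XOR (if bit q u then Y u else 0)" for q
    by (simp add: xor.assoc xor.commute xor.left_commute)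
  ultimately show ?case using step.IH by metis
qed simp

lemma bit_flip: "bit (p XOR 2 ^ s) t \<longleftrightarrow> bit p t \<noteq> (t = s)" for p :: nat
  by (auto simp: bit_xor_iff bit_exp_iff)

lemma label_offset_flip [simp]: "label_offset Y s (p XOR 2 ^ s) = label_offset Y s p"
  by (rule label_offset_cong_bits) (auto simp: bit_flip)

lemma flip_less: "p < 2 ^ J \<Longrightarrow> s < J \<Longrightarrow> p XOR 2 ^ s < 2 ^ J" for p :: nat
  by (intro xor_less_power) auto

lemma flip_div: "(p XOR 2 ^ s) div 2 ^ s = (p div 2 ^ s) XOR 1" for p :: nat
proof -
  have "drop_bit s (p XOR 2 ^ s) = drop_bit s p XOR drop_bit s (2 ^ s)"
    by (rule drop_bit_xor)
  then show ?thesis by (simp add: drop_bit_eq_div)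
qed

lemma flip_div_Suc: "(p XOR 2 ^ s) div 2 ^ Suc s = p div 2 ^ Suc s" for p :: nat
proof -
  have "drop_bit (Suc s) (p XOR 2 ^ s) = drop_bit (Suc s) p XOR drop_bit (Suc s) (2 ^ s)"
    by (rule drop_bit_xor)
  moreover have "drop_bit (Suc s) (2 ^ s :: nat) = 0"
    by (simp add: drop_bit_eq_div)
  ultimately show ?thesis by (simp only: drop_bit_eq_div xor.right_neutral)
qed

lemma flip_mod: "(p XOR 2 ^ s) mod 2 ^ s = p mod 2 ^ s" for p :: nat
proof -
  have "take_bit s (p XOR 2 ^ s) = take_bit s p XOR take_bit s (2 ^ s)"
    by (rule take_bit_xor)
  then show ?thesis by (simp add: take_bit_eq_mod)
qed

lemma dvd_Suc_iff_mod: "2 ^ s dvd Suc p \<longleftrightarrow> p mod 2 ^ s = 2 ^ s - 1"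
proof -
  have "p mod 2 ^ s < 2 ^ s" by simp
  then show ?thesis by (auto simp: dvd_eq_mod_eq_0 mod_Suc split: if_splits)
qed

lemma const_on_blocks:
  assumes step: "\<And>p. Suc p < m \<Longrightarrow> \<not> d dvd Suc p \<Longrightarrow> f p = f (Suc p)"
    and "p < m" "p' < m" "p div d = p' div d"
  shows "f p = f p'"
proof -
  have "p + i < m \<longrightarrow> p div d = (p + i) div d \<longrightarrow> f p = f (p + i)" for p i
  proof (induction i)
    case (Suc i)
    show ?case
    proof (intro impI)
      assume less: "p + Suc i < m" and div: "p div d = (p + Suc i) div d"
      have "p div d \<le> (p + i) div d" "(p + i) div d \<le> Suc (p + i) div d"
        by (simp_all add: div_le_mono)
      with div have eq: "p div d = (p + i) div d" "Suc (p + i) div d = (p + i) div d"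
        unfolding add_Suc_right by linarith+
      have "Suc (p + i) mod d \<noteq> 0"
        using eq(2) by (simp add: div_Suc split: if_splits)
      then have "f (p + i) = f (Suc (p + i))"
        using less by (intro step) (simp_all add: dvd_eq_mod_eq_0)
      moreover have "f p = f (p + i)"
        using Suc.IH less eq(1) by simp
      ultimately show "f p = f (p + Suc i)" by simp
    qed
  qed simp
  note * = this
  show ?thesis
  proof (cases "p \<le> p'")
    case True
    then have "p + (p' - p) = p'" by simp
    then show ?thesis using *[of p "p' - p"] assms(3,4) by metis
  next
    case False
    then have "p' + (p - p') = p" by simp
    then show ?thesis using *[of p' "p - p'"] assms(2,4) by metis
  qed
qed

lemma gadget_div:
  "(a, b) \<in> gadget k r g \<Longrightarrow> a div 2 ^ r = g" "(a, b) \<in> gadget k r g \<Longrightarrow> b div 2 ^ r = g"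
  by (auto simp: gadget_def cells_def)

context
  fixes K k b :: nat and f0 f1 :: "nat \<Rightarrow> nat"
  assumes inj: "inj_on f0 {..<K}" "inj_on f1 {..<K}"
    and range: "f0 ` {..<K} \<subseteq> {..<k}" "f1 ` {..<K} \<subseteq> {..<k}"
begin

text \<open>The equalities of colours that a test forbids: pairs of equally coloured strands whose
  labels would disagree in bit \<open>b\<close> after the merge if that bit of the relation is
  \<open>y\<close>.\<close>

definition clashes :: "bool \<Rightarrow> (nat \<times> nat) set" where
  "clashes y = {(u, v). u < K \<and> v < K \<and> f0 u = f1 v \<and> bit u b \<noteq> (bit v b \<noteq> y)}"

lemma finite_clashes [simp]: "finite (clashes y)"
  by (rule finite_subset[of _ "{..<K} \<times> {..<K}"]) (auto simp: clashes_def)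

text \<open>Two sets of \<open>K\<close> colours out of \<open>k\<close> share at least
  \<open>2 * K - k\<close>, and each shared colour is a clash for one of the two values of the
  bit.\<close>

lemma card_clashes: "2 * K - k \<le> card (clashes True) + card (clashes False)"
proof -
  let ?I = "f0 ` {..<K} \<inter> f1 ` {..<K}"
  have "?I \<subseteq> (\<lambda>(u, v). f0 u) ` (clashes True \<union> clashes False)"
  proof
    fix c assume "c \<in> ?I"
    then obtain u v where uv: "u < K" "v < K" "f0 u = c" "f1 v = c" by auto
    then have "(u, v) \<in> clashes True \<union> clashes False"
      by (auto simp: clashes_def)
    then show "c \<in> (\<lambda>(u, v). f0 u) ` (clashes True \<union> clashes False)"
      by (rule rev_image_eqI) (simp add: uv)
  qed
  then have "card ?I \<le> card (clashes True \<union> clashes False)"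
    by (rule surj_card_le[rotated]) simp
  also have "\<dots> \<le> card (clashes True) + card (clashes False)"
    by (rule card_Un_le)
  finally have I: "card ?I \<le> card (clashes True) + card (clashes False)" .
  have "card (f0 ` {..<K} \<union> f1 ` {..<K}) \<le> k"
    using card_mono[of "{..<k}" "f0 ` {..<K} \<union> f1 ` {..<K}"] range by simp
  moreover have "K + K = card (f0 ` {..<K} \<union> f1 ` {..<K}) + card ?I"
    using card_Un_Int[of "f0 ` {..<K}" "f1 ` {..<K}"] card_image[OF inj(1)] card_image[OF inj(2)]
    by simp
  ultimately show ?thesis using I by simp
qed

text \<open>Every clash must be broken by a change at one of its ends. As \<open>f0\<close> and
  \<open>f1\<close> are injective, the clashes form a partial matching of the strands, and no change
  is counted twice.\<close>

lemma card_clashes_le_changes: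
  assumes "\<And>u v. u < K \<Longrightarrow> v < K \<Longrightarrow> bit u b \<noteq> (bit v b \<noteq> y) \<Longrightarrow> f0' u \<noteq> f1' v"
  shows "card (clashes y) \<le> card {u. u < K \<and> f0 u \<noteq> f0' u} + card {v. v < K \<and> f1 v \<noteq> f1' v}"
proof -
  let ?A = "{e \<in> clashes y. f0 (fst e) \<noteq> f0' (fst e)}"
  let ?B = "{e \<in> clashes y. f1 (snd e) \<noteq> f1' (snd e)}"
  have "clashes y = ?A \<union> ?B"
    using assms by (auto simp: clashes_def) metis+
  then have "card (clashes y) \<le> card ?A + card ?B"
    using card_Un_le[of ?A ?B] by simp
  moreover have "card ?A \<le> card {u. u < K \<and> f0 u \<noteq> f0' u}"
    using inj(2) by (intro card_inj_on_le[of fst]) (auto simp: clashes_def inj_on_def)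
  moreover have "card ?B \<le> card {v. v < K \<and> f1 v \<noteq> f1' v}"
    using inj(1) by (intro card_inj_on_le[of snd]) (auto simp: clashes_def inj_on_def)
  ultimately show ?thesis by linarith
qed

end

section \<open>The requests of the adversary\<close>

text \<open>
  Bundle \<open>p < 2 ^ J\<close> consists of the gadgets \<open>gid p j\<close> with \<open>j < K\<close>, one for each strand. On either side,
  gadget \<open>g\<close> owns the nodes \<open>g * 2 ^ r + x\<close> with \<open>x < 2 ^ r\<close>, and the nodes \<open>hub p\<close> follow. At level \<open>s\<close>
  the bundles with the same \<open>p div 2 ^ s\<close> are linked in a path: \<open>up\<close> leads from the zeroth in-node of a
  gadget to the previous gadget of its strand, or for the first bundle of the path to a hub. The zeroth
  out-nodes of the last bundle of the path are free, and \<open>down\<close> attaches them to hubs: a strand whose new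
  label has bit \<open>b\<close> set goes to the hub of its own bundle, and otherwise to that of the bundle to be merged
  with. Levels below \<open>s0\<close> are merged in advance, so that the edges to hubs are few in comparison with gadgets.
\<close>

locale construction =
  fixes n k l q r J s0 K :: nat
  assumes k: "2 \<le> k" "k \<le> 2 ^ r"
    and K: "K = 2 ^ l * q" "K \<le> k" "2 * k \<le> 3 * K"
    and n: "2 ^ J * K * 2 ^ r + 2 ^ J \<le> n"
    and levels: "s0 < J" "1 \<le> l" "l \<le> 2 ^ s0"
begin

definition gid :: "nat \<Rightarrow> nat \<Rightarrow> nat" where
  "gid p j = p * K + j"

definition hub :: "nat \<Rightarrow> nat" where
  "hub p = 2 ^ J * K * 2 ^ r + p"

definition up :: "(nat \<Rightarrow> nat) \<Rightarrow> nat \<Rightarrow> nat \<Rightarrow> nat \<Rightarrow> edge" where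
  "up Y s p j = (gid p j * 2 ^ r,
     if 2 ^ s dvd p then hub p
     else gid (p - 1) (j XOR (label_offset Y s p XOR label_offset Y s (p - 1))) * 2 ^ r)"

definition down :: "(nat \<Rightarrow> nat) \<Rightarrow> nat \<Rightarrow> nat \<Rightarrow> nat \<Rightarrow> nat \<Rightarrow> edge" where
  "down Y s b p j = (hub (if bit (j XOR label_offset Y (Suc s) p) b then p else p XOR 2 ^ s), gid p j * 2 ^ r)"

definition gadgets :: "edge set" where
  "gadgets = (\<Union>g<2 ^ J * K. gadget k r g)"

definition neutral :: "(nat \<Rightarrow> nat) \<Rightarrow> nat \<Rightarrow> edge set" where
  "neutral Y s = gadgets \<union> (\<lambda>(p, j). up Y s p j) ` ({..<2 ^ J} \<times> {..<K})"

definition test :: "(nat \<Rightarrow> nat) \<Rightarrow> nat \<Rightarrow> nat \<Rightarrow> edge set" where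
  "test Y s b = neutral Y s \<union> (\<lambda>(p, j). down Y s b p j) ` ({p. p < 2 ^ J \<and> 2 ^ s dvd Suc p} \<times> {..<K})"

lemma K_pos: "0 < K"
  using k K by linarith

lemma k_pos: "0 < k"
  using k by simp

lemma gid_div [simp]: "j < K \<Longrightarrow> gid p j div K = p"
  and gid_mod [simp]: "j < K \<Longrightarrow> gid p j mod K = j"
  by (simp_all add: gid_def)

lemma gid_eq_iff [simp]: "j < K \<Longrightarrow> j' < K \<Longrightarrow> gid p j = gid p' j' \<longleftrightarrow> p = p' \<and> j = j'"
  by (metis gid_div gid_mod)

lemma gid_less:
  assumes "p < 2 ^ J" "j < K"
  shows "gid p j < 2 ^ J * K"
proof -
  have "gid p j < Suc p * K" using assms(2) by (simp add: gid_def)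
  also have "\<dots> \<le> 2 ^ J * K" using assms(1) by (intro mult_le_mono1) simp
  finally show ?thesis .
qed

lemma xor_less_K: "j < K \<Longrightarrow> y < 2 ^ l \<Longrightarrow> j XOR y < K"
  unfolding K(1) by (rule xor_less_mult_power)

lemma label_offset_xor_less_K:
  "(\<And>t. Y t < 2 ^ l) \<Longrightarrow> j < K \<Longrightarrow> j XOR label_offset Y s p < K"
  "(\<And>t. Y t < 2 ^ l) \<Longrightarrow> j < K \<Longrightarrow> j XOR (label_offset Y s p XOR label_offset Y s p') < K"
  by (simp_all add: xor_less_K label_offset_less xor_less_power)

lemma hub_inj [simp]: "hub p = hub p' \<longleftrightarrow> p = p'"
  by (simp add: hub_def)

lemma hub_div: "2 ^ J * K \<le> hub p div 2 ^ r"
proof -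
  have "(2 ^ J * K * 2 ^ r) div 2 ^ r \<le> hub p div 2 ^ r"
    by (rule div_le_mono) (simp add: hub_def)
  then show ?thesis by simp
qed

text \<open>\<open>colour C Y s p u\<close> is the colour carried by the strand of label \<open>u\<close> through bundle
  \<open>p\<close>; links between bundles preserve labels.\<close>

definition colour :: "cache \<Rightarrow> (nat \<Rightarrow> nat) \<Rightarrow> nat \<Rightarrow> nat \<Rightarrow> nat \<Rightarrow> nat" where
  "colour C Y s p u = free_colour k r C (gid p (u XOR label_offset Y s p))"

context
  fixes C :: cache and Y :: "nat \<Rightarrow> nat" and s :: nat
  assumes C: "is_cache n k C" and neutral: "neutral Y s \<subseteq> cached C" and Y: "\<And>t. Y t < 2 ^ l"
begin

lemma gadget_cached: "g < 2 ^ J * K \<Longrightarrow> gadget k r g \<subseteq> cached C"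
  using neutral by (auto simp: neutral_def gadgets_def)

lemma up_cached:
  assumes "p < 2 ^ J" "j < K"
  obtains c where "c < k" "up Y s p j \<in> C ! c"
proof -
  have "up Y s p j \<in> cached C"
    using neutral assms by (auto simp: neutral_def)
  then show thesis using that mem_cached_iff[OF C] by blast
qed

lemma colour_less: "p < 2 ^ J \<Longrightarrow> u < K \<Longrightarrow> colour C Y s p u < k"
  unfolding colour_def
  by (intro free_colour_less[OF k(2) k_pos C gadget_cached] gid_less label_offset_xor_less_K Y)

lemma up_colour:
  assumes "p < 2 ^ J" "j < K" "c < k" "up Y s p j \<in> C ! c"
  shows "free_colour k r C (gid p j) = c"
proof -
  have "snd (up Y s p j) div 2 ^ r \<noteq> gid p j"
  proof (cases "2 ^ s dvd p")
    case True
    then show ?thesis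
      using hub_div[of p] gid_less[OF assms(1,2)] by (simp add: up_def)
  next
    case False
    then have "p \<noteq> 0" by (metis dvd_0_right)
    then show ?thesis
      using False assms(2) label_offset_xor_less_K(2)[where Y = Y and s = s and p = p and p' = "p - 1", OF Y assms(2)] by (simp add: up_def)
  qed
  moreover have "up Y s p j = (gid p j * 2 ^ r, snd (up Y s p j))"
    by (simp add: up_def)
  ultimately show ?thesis
    using free_colour_eq_out[OF k(2) k_pos C gadget_cached[OF gid_less[OF assms(1,2)]] assms(3)]
      gadget_div(2) assms(4) by metis
qed

lemma colour_link:
  assumes "Suc p < 2 ^ J" "\<not> 2 ^ s dvd Suc p" "u < K"
  shows "colour C Y s p u = colour C Y s (Suc p) u"
proof -
  define j where "j = u XOR label_offset Y s (Suc p)"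
  define i where "i = u XOR label_offset Y s p"
  have ij: "i < K" "j < K"
    unfolding i_def j_def using assms(3) Y by (auto intro: label_offset_xor_less_K)
  obtain c where c: "c < k" "up Y s (Suc p) j \<in> C ! c"
    using up_cached[OF assms(1) ij(2)] by blast
  have "j XOR (label_offset Y s (Suc p) XOR label_offset Y s p) = i"
    by (simp add: i_def j_def xor.assoc)
  then have up: "up Y s (Suc p) j = (gid (Suc p) j * 2 ^ r, gid p i * 2 ^ r)"
    using assms(2) by (simp add: up_def)
  have "gid (Suc p) j * 2 ^ r div 2 ^ r \<noteq> gid p i"
    using ij by simp
  then have "(gid (Suc p) j * 2 ^ r, gid p i * 2 ^ r) \<notin> gadget k r (gid p i)"
    using gadget_div(1) by blast
  moreover have "gid p i < 2 ^ J * K"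
    using assms(1) ij(1) by (intro gid_less) simp_all
  ultimately have "free_colour k r C (gid p i) = c"
    using c(2) unfolding up by (intro free_colour_eq_in[OF k(2) k_pos C gadget_cached c(1)])
  then show ?thesis
    using up_colour[OF assms(1) ij(2) c] by (simp add: colour_def i_def j_def)
qed

lemma colour_block:
  assumes "p < 2 ^ J" "p' < 2 ^ J" "p div 2 ^ s = p' div 2 ^ s" "u < K"
  shows "colour C Y s p u = colour C Y s p' u"
  by (rule const_on_blocks[where f = "\<lambda>p. colour C Y s p u", OF _ assms(1-3)])
    (rule colour_link[OF _ _ assms(4)])

text \<open>Colours are constant along a path, and in its first bundle the \<open>up\<close> edges
  of all strands end in one hub, so they have different colours.\<close>

lemma colour_inj:
  assumes "p < 2 ^ J"
  shows "inj_on (colour C Y s p) {..<K}"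
proof (rule inj_onI)
  fix u v assume uv: "u \<in> {..<K}" "v \<in> {..<K}" "colour C Y s p u = colour C Y s p v"
  let ?p = "p div 2 ^ s * 2 ^ s"
  let ?u = "u XOR label_offset Y s ?p" and ?v = "v XOR label_offset Y s ?p"
  have p: "?p < 2 ^ J" using assms div_times_less_eq_dividend le_less_trans by blast
  have "colour C Y s ?p u = colour C Y s ?p v"
    using uv colour_block[OF assms p] by simp
  then have eq: "free_colour k r C (gid ?p ?u) = free_colour k r C (gid ?p ?v)"
    by (simp add: colour_def)
  have less: "?u < K" "?v < K" using uv Y by (auto intro: label_offset_xor_less_K)
  obtain c d where cd: "c < k" "up Y s ?p ?u \<in> C ! c" "d < k" "up Y s ?p ?v \<in> C ! d"
    using up_cached[OF p less(1)] up_cached[OF p less(2)] by metis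
  then have "c = d"
    using eq up_colour[OF p less(1) cd(1,2)] up_colour[OF p less(2) cd(3,4)] by simp
  then have "gid ?p ?u * 2 ^ r = gid ?p ?v * 2 ^ r"
    using cache_same_snd[OF C cd(1), of "gid ?p ?u * 2 ^ r" "hub ?p" "gid ?p ?v * 2 ^ r"] cd(2,4)
    by (simp add: up_def)
  then have "?u = ?v" using less by simp
  then show "u = v" by simp
qed

lemma down_colour:
  assumes "p < 2 ^ J" "j < K" "c < k" "down Y s b p j \<in> C ! c"
  shows "free_colour k r C (gid p j) = c"
proof -
  have "fst (down Y s b p j) div 2 ^ r \<noteq> gid p j"
    using hub_div gid_less[OF assms(1,2)] by (simp add: down_def not_le[symmetric] del: not_le) (metis leD)
  moreover have "down Y s b p j = (fst (down Y s b p j), gid p j * 2 ^ r)"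
    by (simp add: down_def)
  ultimately show ?thesis
    using free_colour_eq_in[OF k(2) k_pos C gadget_cached[OF gid_less[OF assms(1,2)]] assms(3)]
      gadget_div(1) assms(4) by metis
qed

text \<open>Both colours can be moved along their paths to the last bundles. There the
  \<open>down\<close> edges of strands whose new labels differ in bit \<open>b\<close> meet in one
  hub and cannot share a colour.\<close>

lemma colour_test:
  assumes test: "test Y s b \<subseteq> cached C" and p: "p < 2 ^ J" "s < J" and uv: "u < K" "v < K"
    and bits: "bit u b \<noteq> (bit v b \<noteq> bit (Y s) b)"
  shows "colour C Y s p u \<noteq> colour C Y s (p XOR 2 ^ s) v"
proof
  assume eq: "colour C Y s p u = colour C Y s (p XOR 2 ^ s) v"
  \<comment> \<open>The last bundle in the block of \<open>p\<close>; its partner \<open>a'\<close>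
    is the last one in the block to be merged with.\<close>
  define a where "a = p div 2 ^ s * 2 ^ s + (2 ^ s - 1)"
  define a' where "a' = a XOR 2 ^ s"
  have "a = (2 ^ s - 1) + p div 2 ^ s * 2 ^ s" by (simp add: a_def)
  then have a: "a div 2 ^ s = p div 2 ^ s" "a mod 2 ^ s = 2 ^ s - 1"
    by (simp_all only: div_mult_self1[OF power_not_zero[OF zero_neq_numeral[symmetric]]] mod_mult_self1) simp_all
  have a': "a' div 2 ^ s = (p XOR 2 ^ s) div 2 ^ s" "a' mod 2 ^ s = 2 ^ s - 1"
    by (simp_all add: a'_def flip_div flip_mod a)
  have dvd: "2 ^ s dvd Suc a" "2 ^ s dvd Suc a'"
    using a(2) a'(2) by (simp_all only: dvd_Suc_iff_mod)
  have J: "2 ^ J = (2 :: nat) ^ (J - s) * 2 ^ s"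
    using p(2) by (simp flip: power_add)
  then have "a div 2 ^ s < 2 ^ (J - s)"
    using p(1) unfolding a(1) by (intro less_mult_imp_div_less) simp
  then have aJ: "a < 2 ^ J"
    unfolding J by (simp add: div_less_iff_less_mult)
  then have a'J: "a' < 2 ^ J" unfolding a'_def using p(2) by (rule flip_less)
  have "colour C Y s a u = colour C Y s a' v"
    using eq colour_block[OF aJ p(1) a(1) uv(1)] colour_block[OF a'J flip_less[OF p] a'(1) uv(2)] by simp
  then have same: "free_colour k r C (gid a (u XOR label_offset Y s a)) = free_colour k r C (gid a' (v XOR label_offset Y s a'))"
    by (simp add: colour_def)
  let ?u = "u XOR label_offset Y s a" and ?v = "v XOR label_offset Y s a'"
  have less: "?u < K" "?v < K" using uv Y by (auto intro: label_offset_xor_less_K)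
  have "down Y s b a ?u \<in> cached C" "down Y s b a' ?v \<in> cached C"
    using test aJ a'J dvd less by (auto simp: test_def)
  then obtain c d where cd: "c < k" "down Y s b a ?u \<in> C ! c" "d < k" "down Y s b a' ?v \<in> C ! d"
    using mem_cached_iff[OF C] by metis
  have "c = d"
    using same down_colour[OF aJ less(1) cd(1,2)] down_colour[OF a'J less(2) cd(3,4)] by simp
  \<comment> \<open>Exactly one of the two blocks is shifted by \<open>Y s\<close> in the
    merge.\<close>
  have ne: "bit a s \<noteq> bit a' s"
    by (simp add: a'_def bit_flip)
  have "?u XOR label_offset Y (Suc s) a = u XOR (if bit a s then Y s else 0)"
    "?v XOR label_offset Y (Suc s) a' = v XOR (if bit a' s then Y s else 0)"
    by (simp_all add: xor.assoc)
  then have "bit (?u XOR label_offset Y (Suc s) a) b \<noteq> bit (?v XOR label_offset Y (Suc s) a') b"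
    using bits ne by (auto simp: bit_xor_iff)
  moreover have "a' XOR 2 ^ s = a" by (simp add: a'_def)
  ultimately have "fst (down Y s b a ?u) = fst (down Y s b a' ?v)"
    by (auto simp: down_def a'_def)
  then have "gid a ?u * 2 ^ r = gid a' ?v * 2 ^ r"
    using cache_same_fst[OF C cd(1), of "fst (down Y s b a ?u)" "gid a ?u * 2 ^ r" "gid a' ?v * 2 ^ r"] cd(2,4) \<open>c = d\<close>
    by (simp add: down_def)
  then have "a = a'" using less by simp
  with ne show False by simp
qed

end

end

section \<open>The cost of revealing one bit to a deterministic algorithm\<close>

context construction
begin

lemma neutral_cong:
  assumes "\<And>t. t < s \<Longrightarrow> Y t = Y' t"
  shows "neutral Y s = neutral Y' s"
proof -
  have "label_offset Y s = label_offset Y' s"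
    using assms by (intro ext label_offset_cong)
  then have "up Y s = up Y' s"
    by (intro ext) (simp add: up_def)
  then show ?thesis by (simp add: neutral_def)
qed

lemma neutral_subset_test: "neutral Y s \<subseteq> test Y s b"
  by (auto simp: test_def)

lemma node_less:
  assumes "g < 2 ^ J * K" "x < 2 ^ r"
  shows "g * 2 ^ r + x < n"
proof -
  have "g * 2 ^ r + x < Suc g * 2 ^ r" using assms(2) by simp
  also have "\<dots> \<le> 2 ^ J * K * 2 ^ r" using assms(1) by (intro mult_le_mono1) simp
  finally show ?thesis using n by linarith
qed

lemma hub_less: "p < 2 ^ J \<Longrightarrow> hub p < n"
  using n by (simp add: hub_def)

lemma test_subset_edges:
  assumes "s < J" "\<And>t. Y t < 2 ^ l"
  shows "test Y s b \<subseteq> edges n"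
proof -
  have node: "gid p j * 2 ^ r < n" if "p < 2 ^ J" "j < K" for p j
    using node_less[OF gid_less[OF that], of 0] by simp
  have "gadget k r g \<subseteq> edges n" if "g < 2 ^ J * K" for g
    using node_less[OF that] by (auto simp: gadget_def cells_def edges_def)
  moreover have "up Y s p j \<in> edges n" if "p < 2 ^ J" "j < K" for p j
    using that node[OF that] node[of "p - 1"] hub_less[OF that(1)]
      label_offset_xor_less_K(2)[where Y = Y and s = s and p = p and p' = "p - 1", OF assms(2) that(2)]
    by (auto simp: up_def edges_def)
  moreover have "down Y s b p j \<in> edges n" if "p < 2 ^ J" "j < K" for p j
    using that node[OF that] hub_less[OF that(1)] hub_less[OF flip_less[OF that(1) assms(1)]]
    by (auto simp: down_def edges_def)
  ultimately show ?thesis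
    by (auto simp: test_def neutral_def gadgets_def)
qed

lemma neutral_subset_edges: "s < J \<Longrightarrow> (\<And>t. Y t < 2 ^ l) \<Longrightarrow> neutral Y s \<subseteq> edges n"
  using test_subset_edges neutral_subset_test by blast

lemma step_cost_ge_strands:
  assumes C: "is_cache n k C" "neutral Y s \<subseteq> cached C" and C': "is_cache n k C'" "neutral Y s \<subseteq> cached C'"
    and Y: "\<And>t. Y t < 2 ^ l"
  shows "(\<Sum>p<2 ^ J. card {u. u < K \<and> colour C Y s p u \<noteq> colour C' Y s p u}) \<le> step_cost k C C'"
proof -
  let ?S = "SIGMA p:{..<2 ^ J}. {u. u < K \<and> colour C Y s p u \<noteq> colour C' Y s p u}"
  let ?f = "\<lambda>(p, u). gid p (u XOR label_offset Y s p)"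
  let ?G = "{g \<in> {..<2 ^ J * K}. free_colour k r C g \<noteq> free_colour k r C' g}"
  have "inj_on ?f ?S"
    by (rule inj_onI) (auto simp: label_offset_xor_less_K[OF Y])
  moreover have "?f ` ?S \<subseteq> ?G"
    by (auto simp: colour_def intro!: gid_less label_offset_xor_less_K[OF Y])
  ultimately have "card ?S \<le> card ?G"
    by (intro card_inj_on_le[of ?f]) auto
  also have "\<dots> \<le> step_cost k C C'"
  proof (rule step_cost_ge_recoloured[OF k(2) k_pos C(1) C'(1)])
    fix g assume "g \<in> {..<2 ^ J * K}"
    then show "gadget k r g \<subseteq> cached C \<and> gadget k r g \<subseteq> cached C'"
      using C(2) C'(2) by (auto simp: neutral_def gadgets_def)
  qed
  finally show ?thesis by simp
qed

text \<open>All bundles of a path pay, not only its ends, since colours are constant along it. Each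
  bundle occurs in the sum as \<open>p\<close> and as the partner of another one, hence the factor
  2. The neutral edges at level \<open>s\<close> do not see \<open>y\<close>, so \<open>C\<close>
  can be fixed before \<open>y\<close>.\<close>

lemma step_cost_test:
  assumes C: "is_cache n k C" "neutral Y s \<subseteq> cached C"
    and C': "is_cache n k C'" "test (Y(s := y)) s b \<subseteq> cached C'"
    and Y: "\<And>t. Y t < 2 ^ l" "y < 2 ^ l" and s: "s < J"
  shows "(\<Sum>p<2 ^ J. card (clashes K b (colour C Y s p) (colour C Y s (p XOR 2 ^ s)) (bit y b)))
    \<le> 2 * step_cost k C C'"
proof -
  let ?Y = "Y(s := y)"
  let ?ch = "\<lambda>p. card {u. u < K \<and> colour C Y s p u \<noteq> colour C' Y s p u}"
  have Y': "?Y t < 2 ^ l" for t using Y by simp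
  have neut: "neutral ?Y s = neutral Y s" by (rule neutral_cong) simp
  have C'n: "neutral Y s \<subseteq> cached C'"
    using C'(2) neutral_subset_test[of ?Y s b] neut by blast
  have col: "colour D ?Y s = colour D Y s" for D
    by (intro ext) (simp add: colour_def label_offset_cong[of s ?Y Y])
  have "card (clashes K b (colour C Y s p) (colour C Y s (p XOR 2 ^ s)) (bit y b)) \<le> ?ch p + ?ch (p XOR 2 ^ s)"
    if p: "p < 2 ^ J" for p
  proof (rule card_clashes_le_changes)
    have p': "p XOR 2 ^ s < 2 ^ J" using p s by (rule flip_less)
    show "inj_on (colour C Y s p) {..<K}" "inj_on (colour C Y s (p XOR 2 ^ s)) {..<K}"
      using colour_inj[OF C Y(1)] p p' by blast+
    show "colour C Y s p ` {..<K} \<subseteq> {..<k}" "colour C Y s (p XOR 2 ^ s) ` {..<K} \<subseteq> {..<k}"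
      using colour_less[OF C Y(1)] p p' by auto
    fix u v assume "u < K" "v < K" "bit u b \<noteq> (bit v b \<noteq> bit y b)"
    then show "colour C' Y s p u \<noteq> colour C' Y s (p XOR 2 ^ s) v"
      using colour_test[of C' ?Y s b p u v] C'(1,2) C'n neut Y' p s by (simp add: col)
  qed
  then have "(\<Sum>p<2 ^ J. card (clashes K b (colour C Y s p) (colour C Y s (p XOR 2 ^ s)) (bit y b)))
      \<le> (\<Sum>p<2 ^ J. ?ch p + ?ch (p XOR 2 ^ s))"
    by (intro sum_mono) auto
  also have "\<dots> = (\<Sum>p<2 ^ J. ?ch p) + (\<Sum>p<2 ^ J. ?ch (p XOR 2 ^ s))"
    by (rule sum.distrib)
  also have "(\<Sum>p<2 ^ J. ?ch (p XOR 2 ^ s)) = (\<Sum>p<2 ^ J. ?ch p)"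
    by (rule sum.reindex_bij_witness[where i = "\<lambda>p. p XOR 2 ^ s" and j = "\<lambda>p. p XOR 2 ^ s"])
      (use s flip_less in auto)
  also have "(\<Sum>p<2 ^ J. ?ch p) + (\<Sum>p<2 ^ J. ?ch p) \<le> 2 * step_cost k C C'"
    using step_cost_ge_strands[OF C C'(1) C'n Y(1)] by simp
  finally show ?thesis .
qed

text \<open>Seen from one cache \<open>C\<close>, the clashes for both values of the bit add up to
  at least \<open>2 * K - k\<close> per bundle, and \<open>2 * (2 * K - k) >= K\<close>. The two
  successor caches together have to pay for them.\<close>

lemma step_cost_both_tests:
  assumes C: "is_cache n k C" "neutral Y s \<subseteq> cached C"
    and C0: "is_cache n k C0" "test (Y(s := y0)) s b \<subseteq> cached C0" "\<not> bit y0 b" "y0 < 2 ^ l"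
    and C1: "is_cache n k C1" "test (Y(s := y1)) s b \<subseteq> cached C1" "bit y1 b" "y1 < 2 ^ l"
    and Y: "\<And>t. Y t < 2 ^ l" and s: "s < J"
  shows "2 ^ J * K \<le> 4 * (step_cost k C C0 + step_cost k C C1)"
proof -
  let ?O = "\<lambda>p y. card (clashes K b (colour C Y s p) (colour C Y s (p XOR 2 ^ s)) y)"
  have "2 * K - k \<le> ?O p True + ?O p False" if p: "p < 2 ^ J" for p
  proof (rule card_clashes)
    have p': "p XOR 2 ^ s < 2 ^ J" using p s by (rule flip_less)
    show "inj_on (colour C Y s p) {..<K}" "inj_on (colour C Y s (p XOR 2 ^ s)) {..<K}"
      using colour_inj[OF C Y] p p' by blast+
    show "colour C Y s p ` {..<K} \<subseteq> {..<k}" "colour C Y s (p XOR 2 ^ s) ` {..<K} \<subseteq> {..<k}"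
      using colour_less[OF C Y] p p' by auto
  qed
  then have "(\<Sum>p<(2::nat) ^ J. 2 * K - k) \<le> (\<Sum>p<2 ^ J. ?O p True + ?O p False)"
    by (intro sum_mono) auto
  also have "\<dots> \<le> 2 * step_cost k C C1 + 2 * step_cost k C C0"
    using step_cost_test[OF C C1(1,2) Y C1(4) s] step_cost_test[OF C C0(1,2) Y C0(4) s] C0(3) C1(3)
    by (simp add: sum.distrib)
  finally have "2 ^ J * (2 * K - k) \<le> 2 * step_cost k C C1 + 2 * step_cost k C C0"
    by simp
  moreover have "2 ^ J * K \<le> 2 ^ J * (2 * (2 * K - k))"
    using K(3) by (intro mult_le_mono2) linarith
  ultimately show ?thesis by (simp add: algebra_simps)
qed

text \<open>As many repetitions as there are gadgets: never holding the whole stage costs as much as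
  recolouring every gadget once.\<close>

abbreviation req :: "edge set \<Rightarrow> edge list" where
  "req \<equiv> requests (2 ^ J * K)"

lemma adversary_det:
  assumes A: "det_online_alg n k A" and \<sigma>: "\<sigma> \<in> lists (edges n)"
    and y0: "\<not> bit y0 b" "y0 < 2 ^ l" and y1: "bit y1 b" "y1 < 2 ^ l"
    and Y: "\<And>t. Y t < 2 ^ l" and s: "s < J"
  shows "8 * alg_cost k A \<sigma> + 2 ^ J * K
    \<le> 4 * (alg_cost k A (\<sigma> @ req (neutral Y s) @ req (test (Y(s := y0)) s b))
       + alg_cost k A (\<sigma> @ req (neutral Y s) @ req (test (Y(s := y1)) s b)))"
proof -
  let ?N = "neutral Y s" and ?T = "\<lambda>y. test (Y(s := y)) s b" and ?c = "alg_cost k A \<sigma>"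
  let ?d = "\<lambda>y. alg_cost k A (\<sigma> @ req ?N @ req (?T y))"
  have mono: "?c \<le> ?d y" "alg_cost k A (\<sigma> @ req ?N) \<le> ?d y" for y
    using alg_cost_append[where A = A and k = k and \<sigma> = \<sigma> and \<tau> = "req ?N @ req (?T y)"]
      alg_cost_append[where A = A and k = k and \<sigma> = "\<sigma> @ req ?N" and \<tau> = "req (?T y)"] by simp_all
  have T: "?T y \<subseteq> edges n" if "y < 2 ^ l" for y
    using test_subset_edges[OF s] Y that by simp
  \<comment> \<open>\<open>one\<close> serves when some stage is paid for in every pass, so that a
    single continuation is expensive enough; \<open>both\<close> serves when the two tests are
    reached from a common cache.\<close>
  have one: "8 * c + q \<le> 4 * (a + b)" "8 * c + q \<le> 4 * (b + a)" if "c + q \<le> a" "c \<le> b" for a b c q :: nat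
    using that by simp_all
  have both: "8 * c + q \<le> 4 * (a + b)" if "c + d \<le> a" "c + e \<le> b" "q \<le> 4 * (d + e)" for a b c d e q :: nat
    using that by simp
  have N: "?N \<subseteq> edges n"
    using s Y by (rule neutral_subset_edges)
  from two_stage_cost[OF A \<sigma> N, of "2 ^ J * K"]
  consider "?c + 2 ^ J * K \<le> alg_cost k A (\<sigma> @ req ?N)"
    | C where "is_cache n k C" "?N \<subseteq> cached C"
      "\<And>F. F \<subseteq> edges n \<Longrightarrow> ?c + 2 ^ J * K \<le> alg_cost k A (\<sigma> @ req ?N @ req F) \<or>
        (\<exists>C'. is_cache n k C' \<and> F \<subseteq> cached C' \<and>
          ?c + step_cost k C C' \<le> alg_cost k A (\<sigma> @ req ?N @ req F))"
    by blast
  then show ?thesis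
  proof cases
    case 1
    then show ?thesis using mono(1)[of y1] mono(2)[of y0] by (intro one) simp_all
  next
    case 2
    from 2(3)[OF T[OF y0(2)]] 2(3)[OF T[OF y1(2)]]
    consider "?c + 2 ^ J * K \<le> ?d y0" | "?c + 2 ^ J * K \<le> ?d y1"
      | C0 C1 where "is_cache n k C0" "?T y0 \<subseteq> cached C0" "?c + step_cost k C C0 \<le> ?d y0"
          "is_cache n k C1" "?T y1 \<subseteq> cached C1" "?c + step_cost k C C1 \<le> ?d y1"
      by blast
    then show ?thesis
    proof cases
      case 1
      then show ?thesis using mono(1)[of y1] by (rule one)
    next
      case 2
      then show ?thesis using mono(1)[of y0] by (rule one)
    next
      case 3
      have "2 ^ J * K \<le> 4 * (step_cost k C C0 + step_cost k C C1)"
        by (rule step_cost_both_tests[OF 2(1,2) 3(1,2) y0 3(4,5) y1 Y s])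
      then show ?thesis by (rule both[OF 3(3,6)])
    qed
  qed
qed

end

section \<open>Expected cost\<close>

lemma finite_caches: "finite {C. is_cache n k C}"
proof (rule finite_subset)
  show "{C. is_cache n k C} \<subseteq> {C. set C \<subseteq> Pow (edges n) \<and> length C = k}"
    unfolding is_cache_def by (auto simp: in_set_conv_nth) blast
  show "finite {C. set C \<subseteq> Pow (edges n) \<and> length C = k}"
    by (rule finite_lists_length_eq) simp
qed

context
  fixes n k :: nat and D :: "det_alg measure"
  assumes D: "randomized_online_alg n k D"
begin

interpretation prob_space D
  using D by (simp add: randomized_online_alg_def)

lemma online: "A \<in> space D \<Longrightarrow> det_online_alg n k A"
  using D by (simp add: randomized_online_alg_def)

lemma cache_of_prefix:
  assumes "A \<in> space D" "\<sigma> \<in> lists (edges n)"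
  shows "is_cache n k (A \<sigma>)"
proof -
  have "feasible n k \<sigma> (run A \<sigma>)"
    using online assms by (simp add: det_online_alg_def)
  then have "is_cache n k (run A \<sigma> (length \<sigma>))"
    by (simp add: feasible_def)
  then show ?thesis by (simp add: run_def)
qed

text \<open>A step cost depends on two caches at once, whereas measurability is given for each cache
  separately. Fixing the first one among its finitely many values leaves a function of the
  second.\<close>

lemma measurable_two_caches:
  assumes \<sigma>: "\<sigma> \<in> lists (edges n)" "\<tau> \<in> lists (edges n)"
  shows "(\<lambda>A. real (f (A \<sigma>) (A \<tau>))) \<in> borel_measurable D"
proof -
  let ?I = "{C. is_cache n k C}"
  have meas: "(\<lambda>A. A \<rho>) \<in> measurable D (count_space ?I)" if \<rho>: "\<rho> \<in> lists (edges n)" for \<rho>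
  proof (rule measurableI)
    show "(\<lambda>A. A \<rho>) -` X \<inter> space D \<in> sets D" if "X \<in> sets (count_space ?I)" for X
      using D \<rho> measurable_sets[of "\<lambda>A. A \<rho>" D "count_space UNIV" X]
      by (simp add: randomized_online_alg_def)
  qed (use cache_of_prefix \<rho> in auto)
  show ?thesis
  proof (rule measurable_compose_countable'[where I = ?I and f = "\<lambda>C A. real (f C (A \<tau>))" and g = "\<lambda>A. A \<sigma>"])
    show "(\<lambda>A. real (f C (A \<tau>))) \<in> borel_measurable D" for C
      by (rule measurable_compose[OF meas[OF \<sigma>(2)]]) simp
  qed (use meas[OF \<sigma>(1)] finite_caches in \<open>auto intro: countable_finite\<close>)
qed

lemma integrable_cost:
  assumes \<sigma>: "\<sigma> \<in> lists (edges n)"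
  shows "integrable D (\<lambda>A. real (alg_cost k A \<sigma>))"
proof -
  have "integrable D (\<lambda>A. real (step_cost k (run A \<sigma> t) (run A \<sigma> (Suc t))))" for t
  proof (rule integrable_const_bound)
    have lists: "take i \<sigma> \<in> lists (edges n)" for i
      using \<sigma> by (auto simp: in_lists_conv_set dest: in_set_takeD)
    then show "(\<lambda>A. real (step_cost k (run A \<sigma> t) (run A \<sigma> (Suc t)))) \<in> borel_measurable D"
      unfolding run_def by (intro measurable_two_caches)
    have "step_cost k (run A \<sigma> t) (run A \<sigma> (Suc t)) \<le> k * card (edges n)" if "A \<in> space D" for A
    proof -
      have C: "is_cache n k (run A \<sigma> (Suc t))"
        unfolding run_def using that lists by (rule cache_of_prefix)
      have "step_cost k (run A \<sigma> t) (run A \<sigma> (Suc t)) \<le> (\<Sum>i<k. card (edges n))"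
        unfolding step_cost_def
      proof (rule sum_mono, rule card_mono)
        fix i assume "i \<in> {..<k}"
        with C show "run A \<sigma> (Suc t) ! i - run A \<sigma> t ! i \<subseteq> edges n"
          by (auto simp: is_cache_def)
      qed simp
      then show ?thesis by simp
    qed
    then show "AE A in D. norm (real (step_cost k (run A \<sigma> t) (run A \<sigma> (Suc t)))) \<le> real (k * card (edges n))"
      by (intro AE_I2) (simp del: of_nat_mult)
  qed
  then show ?thesis
    unfolding schedule_cost_def of_nat_sum by (intro Bochner_Integration.integrable_sum)
qed

lemma opt_cost_le_expected_cost:
  assumes \<sigma>: "\<sigma> \<in> lists (edges n)"
  shows "real (opt_cost n k \<sigma>) \<le> expected_cost k D \<sigma>"
proof -
  have "opt_cost n k \<sigma> \<le> alg_cost k A \<sigma>" if "A \<in> space D" for A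
  proof -
    have "feasible n k \<sigma> (run A \<sigma>)"
      using online[OF that] \<sigma> by (simp add: det_online_alg_def)
    then show ?thesis
      unfolding opt_cost_def by (intro cInf_lower) auto
  qed
  then have "(\<integral>A. real (opt_cost n k \<sigma>) \<partial>D) \<le> expected_cost k D \<sigma>"
    unfolding expected_cost_def by (intro integral_mono integrable_cost \<sigma>) auto
  then show ?thesis by (simp add: prob_space)
qed

text \<open>The oblivious adversary knows the distribution of the algorithm, so of two continuations it
  can choose the one that is more expensive in expectation.\<close>

lemma choose_continuation:
  assumes \<sigma>: "\<sigma> \<in> lists (edges n)" and \<tau>: "\<sigma> @ \<tau>0 \<in> lists (edges n)" "\<sigma> @ \<tau>1 \<in> lists (edges n)"
    and cost: "\<And>A. det_online_alg n k A \<Longrightarrow>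
      8 * alg_cost k A \<sigma> + c \<le> 4 * (alg_cost k A (\<sigma> @ \<tau>0) + alg_cost k A (\<sigma> @ \<tau>1))"
  shows "expected_cost k D \<sigma> + real c / 8 \<le> expected_cost k D (\<sigma> @ \<tau>0) \<or>
    expected_cost k D \<sigma> + real c / 8 \<le> expected_cost k D (\<sigma> @ \<tau>1)"
proof -
  have "8 * expected_cost k D \<sigma> + real c = (\<integral>A. 8 * real (alg_cost k A \<sigma>) + real c \<partial>D)"
    unfolding expected_cost_def using integrable_cost[OF \<sigma>] by (simp add: prob_space)
  also have "\<dots> \<le> (\<integral>A. 4 * (real (alg_cost k A (\<sigma> @ \<tau>0)) + real (alg_cost k A (\<sigma> @ \<tau>1))) \<partial>D)"
  proof (rule integral_mono)
    fix A assume "A \<in> space D"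
    then have "real (8 * alg_cost k A \<sigma> + c) \<le> real (4 * (alg_cost k A (\<sigma> @ \<tau>0) + alg_cost k A (\<sigma> @ \<tau>1)))"
      using cost online by (simp only: of_nat_le_iff)
    then show "8 * real (alg_cost k A \<sigma>) + real c
        \<le> 4 * (real (alg_cost k A (\<sigma> @ \<tau>0)) + real (alg_cost k A (\<sigma> @ \<tau>1)))"
      by simp
  qed (use integrable_cost \<sigma> \<tau> in auto)
  also have "\<dots> = 4 * (expected_cost k D (\<sigma> @ \<tau>0) + expected_cost k D (\<sigma> @ \<tau>1))"
    unfolding expected_cost_def using integrable_cost[OF \<tau>(1)] integrable_cost[OF \<tau>(2)] by simp
  finally show ?thesis by (simp add: field_simps) linarith
qed

end

section \<open>Offline schedules\<close>

primrec walk_cost :: "nat \<Rightarrow> cache \<Rightarrow> cache list \<Rightarrow> nat" where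
  "walk_cost k C [] = 0"
| "walk_cost k C (C' # Cs) = step_cost k C C' + walk_cost k C' Cs"

lemma walk_cost_append: "walk_cost k C (Cs @ Cs') = walk_cost k C Cs + walk_cost k (last (C # Cs)) Cs'"
  by (induction Cs arbitrary: C) auto

text \<open>Offline, one cache per block suffices: it is entered on the first request of the block
  and then kept.\<close>

lemma schedule_of_walk:
  assumes "\<forall>(es, C) \<in> set xs. es \<noteq> [] \<and> is_cache n k C \<and> set es \<subseteq> cached C"
  shows "\<exists>S. feasible n k (concat (map fst xs)) S \<and>
    S (length (concat (map fst xs))) = last (replicate k {} # map snd xs) \<and>
    schedule_cost k (concat (map fst xs)) S = walk_cost k (replicate k {}) (map snd xs)"
  using assms
proof (induction xs rule: rev_induct)
  case Nil
  show ?case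
    by (intro exI[of _ "\<lambda>_. replicate k {}"]) (simp add: feasible_def is_cache_empty schedule_cost_def)
next
  case (snoc x xs)
  obtain es C where x: "x = (es, C)" by fastforce
  have es: "es \<noteq> []" and C: "is_cache n k C" and sub: "set es \<subseteq> cached C"
    using snoc.prems by (simp_all add: x)
  let ?\<sigma> = "concat (map fst xs)"
  let ?m = "length ?\<sigma>"
  from snoc obtain S where S: "feasible n k ?\<sigma> S" "S ?m = last (replicate k {} # map snd xs)"
    "schedule_cost k ?\<sigma> S = walk_cost k (replicate k {}) (map snd xs)"
    by auto
  \<comment> \<open>At time \<open>?m\<close> the old cache is still held; the switch is the step
    from \<open>?m\<close> to \<open>Suc ?m\<close>, which exists because \<open>es\<close> is
    nonempty.\<close>
  define S' where "S' t = (if t \<le> ?m then S t else C)" for t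
  have "(?\<sigma> @ es) ! t \<in> cached (S' (Suc t))"
    if "t < ?m + length es" "(?\<sigma> @ es) ! t \<notin> cached (S' t)" for t
  proof (cases "t < ?m")
    case True
    then show ?thesis using S(1) that by (simp add: feasible_def S'_def nth_append)
  next
    case False
    then have "(?\<sigma> @ es) ! t \<in> set es" using that by (simp add: nth_append)
    then show ?thesis using sub False by (auto simp: S'_def)
  qed
  then have feas: "feasible n k (?\<sigma> @ es) S'"
    using S(1) C by (simp add: feasible_def S'_def)
  have "segment_cost k S' 0 ?m = segment_cost k S 0 ?m"
    by (rule segment_cost_cong) (simp add: S'_def)
  moreover have "segment_cost k S' ?m (?m + length es) = step_cost k (S ?m) C"
    using es unfolding segment_cost_def
    by (subst sum.atLeast_Suc_lessThan) (auto simp: S'_def intro!: sum.neutral)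
  ultimately have "schedule_cost k (?\<sigma> @ es) S' = walk_cost k (replicate k {}) (map snd (xs @ [x]))"
    using S(2,3) unfolding schedule_cost_eq_segment
    by (subst segment_cost_append[of _ ?m]) (simp_all add: walk_cost_append x)
  moreover have "S' (length (?\<sigma> @ es)) = C"
    using es by (simp add: S'_def)
  ultimately show ?case
    using feas by (intro exI[of _ S']) (simp add: x)
qed

lemma opt_cost_le_walk_cost:
  assumes "\<forall>(es, C) \<in> set xs. es \<noteq> [] \<and> is_cache n k C \<and> set es \<subseteq> cached C"
  shows "opt_cost n k (concat (map fst xs)) \<le> walk_cost k (replicate k {}) (map snd xs)"
proof -
  obtain S where "feasible n k (concat (map fst xs)) S"
    "schedule_cost k (concat (map fst xs)) S = walk_cost k (replicate k {}) (map snd xs)"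
    using schedule_of_walk[OF assms] by blast
  then have "walk_cost k (replicate k {}) (map snd xs) \<in>
      {schedule_cost k (concat (map fst xs)) S | S. feasible n k (concat (map fst xs)) S}"
    by force
  then show ?thesis
    unfolding opt_cost_def by (rule cInf_lower) simp
qed

definition colour_classes :: "nat \<Rightarrow> (edge \<Rightarrow> nat) \<Rightarrow> edge set \<Rightarrow> cache" where
  "colour_classes k f E = map (\<lambda>c. {e \<in> E. f e = c}) [0..<k]"

lemma is_cache_colour_classes:
  assumes "E \<subseteq> edges n"
    and "\<And>e e'. e \<in> E \<Longrightarrow> e' \<in> E \<Longrightarrow> f e = f e' \<Longrightarrow> fst e = fst e' \<Longrightarrow> e = e'"
    and "\<And>e e'. e \<in> E \<Longrightarrow> e' \<in> E \<Longrightarrow> f e = f e' \<Longrightarrow> snd e = snd e' \<Longrightarrow> e = e'"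
  shows "is_cache n k (colour_classes k f E)"
  using assms(1) unfolding is_cache_def colour_classes_def matching_def
  by (auto intro!: inj_onI dest: assms(2,3))

lemma cached_colour_classes: "(\<And>e. e \<in> E \<Longrightarrow> f e < k) \<Longrightarrow> cached (colour_classes k f E) = E"
  by (auto simp: cached_def colour_classes_def)

lemma step_cost_colour_classes:
  assumes "finite E'"
  shows "step_cost k (colour_classes k f E) (colour_classes k f' E') \<le> card {e \<in> E'. \<not> (e \<in> E \<and> f e = f' e)}"
proof -
  have "step_cost k (colour_classes k f E) (colour_classes k f' E')
      = (\<Sum>c<k. card ({e \<in> E'. f' e = c} - {e \<in> E. f e = c}))"
    by (simp add: step_cost_def colour_classes_def)
  also have "\<dots> = card (\<Union>c<k. {e \<in> E'. f' e = c} - {e \<in> E. f e = c})"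
    using assms by (subst card_UN_disjoint) auto
  also have "\<dots> \<le> card {e \<in> E'. \<not> (e \<in> E \<and> f e = f' e)}"
    using assms by (intro card_mono) auto
  finally show ?thesis .
qed

lemma step_cost_from_empty:
  assumes "is_cache n k C"
  shows "step_cost k (replicate k {}) C \<le> card (edges n)"
proof -
  have "step_cost k (replicate k {}) C = (\<Sum>i<k. card (C ! i))"
    by (simp add: step_cost_def)
  also have "\<dots> = card (\<Union>i<k. C ! i)"
    using assms is_cache_nth_finite[OF assms] by (subst card_UN_disjoint) (auto simp: is_cache_def)
  also have "\<dots> \<le> card (edges n)"
    using assms by (intro card_mono) (auto simp: is_cache_def)
  finally show ?thesis .
qed

text \<open>Starting from the colouring \<open>x XOR y\<close>, exchanging the colours \<open>a\<close> and 0 on the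
  2 by 2 subsquare of rows and columns 0 and \<open>a\<close> makes \<open>a\<close> free. So any two of these
  colourings differ in at most six cells.\<close>

definition cell_colouring :: "nat \<Rightarrow> nat \<Rightarrow> nat \<Rightarrow> nat" where
  "cell_colouring a x y = (if x \<in> {0, a} \<and> y \<in> {0, a} then a XOR (x XOR y) else x XOR y)"

lemma cell_colouring_sym: "cell_colouring a x y = cell_colouring a y x"
  by (simp add: cell_colouring_def xor.commute)

lemma xor_eq_self_iff [simp]:
  fixes x y :: nat
  shows "x XOR y = x \<longleftrightarrow> y = 0" "y XOR x = x \<longleftrightarrow> y = 0"
  by (metis xor.right_neutral xor_eq_iff(1), metis xor.left_neutral xor_eq_iff(2))

lemma cell_colouring_less: "(x, y) \<in> cells k r \<Longrightarrow> a < k \<Longrightarrow> cell_colouring a x y < k"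
  by (auto simp: cell_colouring_def cells_def)

text \<open>In the rows 0 and \<open>a\<close>, a column \<open>u\<close> among 0 and
  \<open>a\<close> receives the former colour of column \<open>a XOR u\<close>. This permutes the
  two columns, so no collision with other columns arises.\<close>

lemma cell_colouring_row:
  assumes "cell_colouring a x y = cell_colouring a x y'"
  shows "y = y'"
proof -
  have ne: "a XOR (x XOR u) \<noteq> x XOR v" if "x \<in> {0, a}" "u \<in> {0, a}" "v \<notin> {0, a}" for u v
  proof
    assume "a XOR (x XOR u) = x XOR v"
    then have "x XOR (a XOR u) = x XOR v"
      by (simp only: xor.left_commute)
    then have "a XOR u = v" by simp
    with that show False by auto
  qed
  have "a XOR (x XOR u) = a XOR (x XOR v) \<longleftrightarrow> u = v" "x XOR u = x XOR v \<longleftrightarrow> u = v" for u v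
    by simp_all
  with assms ne[of y y'] ne[of y' y] show ?thesis
    unfolding cell_colouring_def by (metis (full_types))
qed

text \<open>In row zero the colour \<open>a\<close> would sit in column 0, which is the removed
  cell.\<close>

lemma cell_colouring_free: "(0, y) \<in> cells k r \<Longrightarrow> cell_colouring a 0 y \<noteq> a"
  by (auto simp: cell_colouring_def cells_def)

lemma cell_colouring_diff:
  "{(x, y). (x, y) \<in> cells k r \<and> cell_colouring a x y \<noteq> cell_colouring a' x y}
    \<subseteq> set [(a, a), (0, a), (a, 0), (a', a'), (0, a'), (a', 0)]"
proof (rule subsetI, clarify)
  fix x y assume cell: "(x, y) \<in> cells k r" and ne: "cell_colouring a x y \<noteq> cell_colouring a' x y"
  then have "x \<in> {0, a} \<and> y \<in> {0, a} \<or> x \<in> {0, a'} \<and> y \<in> {0, a'}"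
    unfolding cell_colouring_def by presburger
  with cell show "(x, y) \<in> set [(a, a), (0, a), (a, 0), (a', a'), (0, a'), (a', 0)]"
    unfolding cells_def by auto
qed

section \<open>The offline colouring of a phase and its properness\<close>

context construction
begin

text \<open>The label after all \<open>J\<close> levels is the colour from the beginning of the
  phase. By \<open>label_offset_high\<close>, labels within a merged block agree iff the final
  labels agree.\<close>

definition strand_colour :: "(nat \<Rightarrow> nat) \<Rightarrow> nat \<Rightarrow> nat" where
  "strand_colour Y g = (g mod K) XOR label_offset Y J (g div K)"

text \<open>Hubs have quotients of at least \<open>2 ^ J * K\<close>, so the last branch catches the
  \<open>down\<close> edges, whose gadget is on the out-side. An \<open>up\<close> edge takes the
  colour of the gadget that it starts from.\<close>

definition edge_colour :: "(nat \<Rightarrow> nat) \<Rightarrow> edge \<Rightarrow> nat" where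
  "edge_colour Y e = (let g = fst e div 2 ^ r; h = snd e div 2 ^ r in
     if g = h then cell_colouring (strand_colour Y g) (fst e mod 2 ^ r) (snd e mod 2 ^ r)
     else if g < 2 ^ J * K then strand_colour Y g else strand_colour Y h)"

lemma strand_colour_less: "(\<And>t. Y t < 2 ^ l) \<Longrightarrow> strand_colour Y g < k"
  unfolding strand_colour_def
  by (rule order_less_le_trans[OF label_offset_xor_less_K(1) K(2)]) (simp_all add: K_pos)

lemma strand_colour_gid [simp]: "j < K \<Longrightarrow> strand_colour Y (gid p j) = j XOR label_offset Y J p"
  by (simp add: strand_colour_def)

lemma edge_colour_cell:
  "(x, y) \<in> cells k r \<Longrightarrow>
    edge_colour Y (g * 2 ^ r + x, g * 2 ^ r + y) = cell_colouring (strand_colour Y g) x y"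
  by (simp add: edge_colour_def cells_def)

lemma snd_up:
  assumes "\<And>t. Y t < 2 ^ l" "p < 2 ^ J" "j < K"
  shows "2 ^ s dvd p \<and> snd (up Y s p j) = hub p \<or>
    (\<exists>p' j'. p = Suc p' \<and> \<not> 2 ^ s dvd Suc p' \<and> j' < K \<and> snd (up Y s p j) = gid p' j' * 2 ^ r \<and>
      j' = j XOR (label_offset Y s p XOR label_offset Y s p'))"
proof (cases "2 ^ s dvd p")
  case False
  then obtain p' where "p = Suc p'" by (cases p) auto
  with False show ?thesis
    using label_offset_xor_less_K(2)[where Y = Y and s = s and p = p and p' = p', OF assms(1,3)]
    by (simp add: up_def)
qed (simp add: up_def)

lemma fst_up: "fst (up Y s p j) = gid p j * 2 ^ r"
  by (simp add: up_def)

lemma hub_neq_node [simp]: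
  assumes "g < 2 ^ J * K" "x < 2 ^ r"
  shows "hub p \<noteq> g * 2 ^ r + x"
proof
  assume "hub p = g * 2 ^ r + x"
  then have "hub p div 2 ^ r = g" using assms(2) by simp
  with hub_div[of p] assms(1) show False by simp
qed

lemma fst_down_neq_node: "g < 2 ^ J * K \<Longrightarrow> x < 2 ^ r \<Longrightarrow> fst (down Y s b p j) \<noteq> g * 2 ^ r + x"
  by (simp add: down_def)

lemma node_eq_iff:
  fixes g g' x x' :: nat
  assumes "x < 2 ^ r" "x' < 2 ^ r"
  shows "g * 2 ^ r + x = g' * 2 ^ r + x' \<longleftrightarrow> g = g' \<and> x = x'"
proof
  assume eq: "g * 2 ^ r + x = g' * 2 ^ r + x'"
  have "g = (g * 2 ^ r + x) div 2 ^ r" "x = (g * 2 ^ r + x) mod 2 ^ r"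
    using assms by simp_all
  then show "g = g' \<and> x = x'" unfolding eq using assms by simp
qed simp

lemma edge_colour_up:
  assumes "\<And>t. Y t < 2 ^ l" "p < 2 ^ J" "j < K"
  shows "edge_colour Y' (up Y s p j) = strand_colour Y' (gid p j)"
proof -
  have "snd (up Y s p j) div 2 ^ r \<noteq> gid p j"
    using snd_up[where Y = Y and s = s, OF assms] hub_div[of p] gid_less[OF assms(2,3)] assms(3) by auto
  then show ?thesis
    using gid_less[OF assms(2,3)] by (simp add: edge_colour_def Let_def fst_up)
qed

lemma edge_colour_down:
  assumes "p < 2 ^ J" "j < K"
  shows "edge_colour Y (down Y s b p j) = strand_colour Y (gid p j)"
proof -
  have "2 ^ J * K \<le> fst (down Y s b p j) div 2 ^ r"
    using hub_div by (simp add: down_def)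
  then show ?thesis
    using gid_less[OF assms] by (simp add: edge_colour_def Let_def) (simp add: down_def)
qed

lemma mem_testE:
  assumes "e \<in> test Y s b"
  obtains (cell) g x y where "g < 2 ^ J * K" "(x, y) \<in> cells k r" "x < 2 ^ r" "y < 2 ^ r"
      "e = (g * 2 ^ r + x, g * 2 ^ r + y)"
    | (up) p j where "p < 2 ^ J" "j < K" "e = up Y s p j"
    | (down) p j where "p < 2 ^ J" "2 ^ s dvd Suc p" "j < K" "e = down Y s b p j"
proof -
  consider "e \<in> gadgets" | "e \<in> (\<lambda>(p, j). up Y s p j) ` ({..<2 ^ J} \<times> {..<K})"
    | "e \<in> (\<lambda>(p, j). down Y s b p j) ` ({p. p < 2 ^ J \<and> 2 ^ s dvd Suc p} \<times> {..<K})"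
    using assms unfolding test_def neutral_def by blast
  then show thesis
  proof cases
    case 1
    then obtain g x y where "g < 2 ^ J * K" "(x, y) \<in> cells k r" "e = (g * 2 ^ r + x, g * 2 ^ r + y)"
      by (auto simp: gadgets_def gadget_def)
    then show thesis by (intro cell[of g x y]) (auto simp: cells_def)
  next
    case 2
    then show thesis using up by auto
  next
    case 3
    then show thesis using down by auto
  qed
qed

context
  fixes Y :: "nat \<Rightarrow> nat" and s b :: nat
  assumes Y: "\<And>t. Y t < 2 ^ l" and s: "s < J"
begin

lemma edge_colour_less:
  assumes "e \<in> test Y s b"
  shows "edge_colour Y e < k"
  using assms
proof (cases rule: mem_testE)
  case (cell g x y)
  then show ?thesis using cell_colouring_less strand_colour_less[of Y] Y by (simp add: edge_colour_cell)
next
  case (up p j)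
  then show ?thesis using strand_colour_less[of Y] Y edge_colour_up[of Y p j Y s] by (simp del: strand_colour_gid)
next
  case (down p j)
  then show ?thesis using strand_colour_less[of Y] Y edge_colour_down[of p j Y s b] by (simp del: strand_colour_gid)
qed

lemma proper_fst_cell_up:
  assumes "g < 2 ^ J * K" "(x, y) \<in> cells k r" "x < 2 ^ r" "p < 2 ^ J" "j < K"
    and "edge_colour Y (g * 2 ^ r + x, g * 2 ^ r + y) = edge_colour Y (up Y s p j)"
  shows "g * 2 ^ r + x \<noteq> fst (up Y s p j)"
proof
  assume "g * 2 ^ r + x = fst (up Y s p j)"
  then have "g = gid p j" "x = 0"
    using node_eq_iff[of x 0 g "gid p j"] assms(3) by (simp_all add: fst_up)
  then show False
    using assms(2,6) cell_colouring_free[of y k r "strand_colour Y g"]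
      edge_colour_cell[OF assms(2), of Y g] edge_colour_up[where Y = Y and Y' = Y and s = s, OF Y assms(4,5)] by simp
qed

text \<open>Two different bundles at one hub are partners, and the labels of the two strands differ
  in bit \<open>b\<close>. Equal colours are equal final labels, hence equal labels after level
  \<open>s\<close>, because higher levels shift partners alike.\<close>

lemma proper_fst_down:
  assumes p: "p < 2 ^ J" "j < K" "p' < 2 ^ J" "j' < K"
    and col: "edge_colour Y (down Y s b p j) = edge_colour Y (down Y s b p' j')"
    and eq: "fst (down Y s b p j) = fst (down Y s b p' j')"
  shows "p = p' \<and> j = j'"
proof -
  have col': "j XOR label_offset Y J p = j' XOR label_offset Y J p'"
    using col p by (simp add: edge_colour_down)
  let ?u = "j XOR label_offset Y (Suc s) p" and ?u' = "j' XOR label_offset Y (Suc s) p'"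
  have hub: "(if bit ?u b then p else p XOR 2 ^ s) = (if bit ?u' b then p' else p' XOR 2 ^ s)"
    using eq by (simp add: down_def split: if_splits)
  show ?thesis
  proof (cases "p = p'")
    case True
    then show ?thesis using col' by simp
  next
    case False
    then have bits: "bit ?u b \<noteq> bit ?u' b" and flip: "p' = p XOR 2 ^ s"
      using hub by (auto split: if_splits)
    have "label_offset Y J p XOR label_offset Y (Suc s) p = label_offset Y J p' XOR label_offset Y (Suc s) p'"
      using s by (intro label_offset_high) (simp_all add: flip flip_div_Suc del: power_Suc)
    moreover have "w XOR label_offset Y (Suc s) q
        = (w XOR label_offset Y J q) XOR (label_offset Y J q XOR label_offset Y (Suc s) q)" for w q
      by (simp only: xor.assoc xor_cancel)
    ultimately have "?u = ?u'" using col' by metis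
    with bits show ?thesis by simp
  qed
qed

lemma proper_fst:
  assumes e: "e \<in> test Y s b" "e' \<in> test Y s b" "edge_colour Y e = edge_colour Y e'" "fst e = fst e'"
  shows "e = e'"
  using e(1)
proof (cases rule: mem_testE)
  case c: (cell g x y)
  show ?thesis
    using e(2)
  proof (cases rule: mem_testE)
    case c': (cell g' x' y')
    have "g' = g" "x' = x"
      using e(4) c c' node_eq_iff[of x' x g' g] by auto
    moreover from this have "y = y'"
      using e(3) c c' cell_colouring_row[of "strand_colour Y g" x y y'] by (simp add: edge_colour_cell)
    ultimately show ?thesis using c c' by simp
  next
    case up: (up p j)
    then show ?thesis
      using proper_fst_cell_up[OF c(1,2,3) up(1,2)] e(3,4) c(5) by simp
  next
    case down: (down p j)
    then show ?thesis using e(4) c fst_down_neq_node[OF c(1,3), of Y s b p j] by simp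
  qed
next
  case u: (up p j)
  show ?thesis
    using e(2)
  proof (cases rule: mem_testE)
    case c: (cell g x y)
    then show ?thesis
      using proper_fst_cell_up[OF c(1,2,3) u(1,2)] e(3,4) u(3) by simp
  next
    case u': (up p' j')
    then have "gid p j = gid p' j'" using e(4) u by (simp add: fst_up)
    then show ?thesis using u u' by simp
  next
    case d: (down p' j')
    then show ?thesis
      using e(4) u fst_down_neq_node[OF gid_less[OF u(1,2)], of 0 Y s b p' j'] by (simp add: fst_up)
  qed
next
  case d: (down p j)
  show ?thesis
    using e(2)
  proof (cases rule: mem_testE)
    case c: (cell g x y)
    then show ?thesis using e(4) d fst_down_neq_node[OF c(1,3), of Y s b p j] by simp
  next
    case u: (up p' j')
    then show ?thesis
      using e(4) d fst_down_neq_node[OF gid_less[OF u(1,2)], of 0 Y s b p j] by (simp add: fst_up)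
  next
    case d': (down p' j')
    then show ?thesis
      using proper_fst_down[OF d(1,3) d'(1,3)] e(3,4) d(4) by simp
  qed
qed

text \<open>\<open>p\<close> and \<open>Suc p\<close> lie in one block, so the levels from
  \<open>s\<close> on shift both alike, and a link preserves the final label, hence the
  colour.\<close>

lemma link_colour:
  assumes "\<not> 2 ^ s dvd Suc p"
  shows "(j XOR (label_offset Y s (Suc p) XOR label_offset Y s p)) XOR label_offset Y J p
    = j XOR label_offset Y J (Suc p)"
proof -
  have "Suc p div 2 ^ s = p div 2 ^ s"
    using assms by (simp add: div_Suc dvd_eq_mod_eq_0)
  then have "label_offset Y J (Suc p) XOR label_offset Y s (Suc p) = label_offset Y J p XOR label_offset Y s p"
    using s by (intro label_offset_high) auto
  then have "label_offset Y J (Suc p)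
      = (label_offset Y J p XOR label_offset Y s p) XOR label_offset Y s (Suc p)"
    by (metis xor_cancel(2))
  then show ?thesis by (simp only: xor.assoc xor.commute xor.left_commute)
qed

lemma proper_snd_cell:
  assumes c: "g < 2 ^ J * K" "(x, y) \<in> cells k r" "y < 2 ^ r"
    and e: "snd e = h * 2 ^ r" "edge_colour Y e = strand_colour Y h"
    and eq: "edge_colour Y (g * 2 ^ r + x, g * 2 ^ r + y) = edge_colour Y e" "g * 2 ^ r + y = snd e"
  shows False
proof -
  have "g = h" "y = 0"
    using node_eq_iff[of y 0 g h] c(3) e(1) eq(2) by simp_all
  then show False
    using eq(1) e(2) c(2) edge_colour_cell[OF c(2), of Y g] cell_colouring_sym[of _ x 0]
      cell_colouring_free[of x k r "strand_colour Y g"] cells_sym[of x 0 k r] by simp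
qed

lemma up_cases:
  assumes "p < 2 ^ J" "j < K"
  obtains (hub) "2 ^ s dvd p" "snd (up Y s p j) = hub p"
    | (link) p' j' where "p = Suc p'" "\<not> 2 ^ s dvd Suc p'" "j' < K"
      "snd (up Y s p j) = gid p' j' * 2 ^ r" "j' = j XOR (label_offset Y s p XOR label_offset Y s p')"
      "edge_colour Y (up Y s p j) = strand_colour Y (gid p' j')" "gid p' j' < 2 ^ J * K"
proof -
  have col: "edge_colour Y (up Y s p j) = j XOR label_offset Y J p"
    using edge_colour_up[where Y = Y and Y' = Y and s = s, OF Y assms] assms(2) by simp
  from snd_up[where Y = Y and s = s, OF Y assms] show thesis
  proof (elim disjE conjE exE)
    fix p' j'
    assume *: "p = Suc p'" "\<not> 2 ^ s dvd Suc p'" "j' < K" "snd (up Y s p j) = gid p' j' * 2 ^ r"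
      "j' = j XOR (label_offset Y s p XOR label_offset Y s p')"
    then show thesis
      using col link_colour[of p' j] gid_less[of p' j'] assms(1)
      by (intro link[of p' j']) simp_all
  qed (rule hub)
qed

lemma proper_snd:
  assumes e: "e \<in> test Y s b" "e' \<in> test Y s b" "edge_colour Y e = edge_colour Y e'" "snd e = snd e'"
  shows "e = e'"
proof -
  have cell_up: False
    if "g < 2 ^ J * K" "(x, y) \<in> cells k r" "y < 2 ^ r" "p < 2 ^ J" "j < K"
      "edge_colour Y (g * 2 ^ r + x, g * 2 ^ r + y) = edge_colour Y (up Y s p j)"
      "g * 2 ^ r + y = snd (up Y s p j)" for g x y p j
    using that(4,5)
  proof (cases rule: up_cases)
    case hub
    then show False using hub_neq_node[OF that(1,3), of p] that(7) by simp
  next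
    case (link p' j')
    then show False using proper_snd_cell[OF that(1-3) _ _ that(6,7)] by blast
  qed
  have cell_down: False
    if "g < 2 ^ J * K" "(x, y) \<in> cells k r" "y < 2 ^ r" "p < 2 ^ J" "j < K"
      "edge_colour Y (g * 2 ^ r + x, g * 2 ^ r + y) = edge_colour Y (down Y s b p j)"
      "g * 2 ^ r + y = snd (down Y s b p j)" for g x y p j
    using proper_snd_cell[OF that(1-3) _ _ that(6,7)] edge_colour_down[OF that(4,5), of Y s b]
    by (simp add: down_def)
  \<comment> \<open>A link arrives at \<open>p'\<close> only from a \<open>Suc p'\<close> in the
    same block, a \<open>down\<close> edge only at the end of a block.\<close>
  have up_down: False
    if "p < 2 ^ J" "j < K" "p' < 2 ^ J" "2 ^ s dvd Suc p'" "j' < K"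
      "snd (up Y s p j) = snd (down Y s b p' j')" for p j p' j'
    using that(1,2)
  proof (cases rule: up_cases)
    case hub
    then show False using hub_neq_node[OF gid_less[OF that(3,5)], of 0 p] that(6) by (simp add: down_def)
  next
    case (link p'' j'')
    then have "p'' = p'" using that by (simp add: down_def)
    then show False using link that by simp
  qed
  \<comment> \<open>The out-end determines the bundle, and within one bundle equal colours mean
    equal strands.\<close>
  have up_up: "p = p' \<and> j = j'"
    if p: "p < 2 ^ J" "j < K" "p' < 2 ^ J" "j' < K"
      and col: "edge_colour Y (up Y s p j) = edge_colour Y (up Y s p' j')"
      and eq: "snd (up Y s p j) = snd (up Y s p' j')" for p j p' j'
  proof -
    have col': "j XOR label_offset Y J p = j' XOR label_offset Y J p'"
      using col edge_colour_up[where Y = Y and Y' = Y and s = s, OF Y p(1,2)]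
        edge_colour_up[where Y = Y and Y' = Y and s = s, OF Y p(3,4)] p by simp
    have "p = p'"
      using p(1,2)
    proof (cases rule: up_cases)
      case h: hub
      show ?thesis
        using p(3,4)
      proof (cases rule: up_cases)
        case hub
        then show ?thesis using h eq by simp
      next
        case (link q i)
        then show ?thesis using h eq hub_neq_node[OF link(7), of 0 p] by simp
      qed
    next
      case l: (link q i)
      show ?thesis
        using p(3,4)
      proof (cases rule: up_cases)
        case hub
        then show ?thesis using l eq hub_neq_node[OF l(7), of 0 p'] by simp
      next
        case (link q' i')
        have "gid q i * 2 ^ r = gid q' i' * 2 ^ r"
          using eq unfolding l(4) link(4) .
        then have "q = q'" using l(3) link(3) by simp
        then show ?thesis using l(1) link(1) by simp
      qed
    qed
    with col' show ?thesis by simp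
  qed
  show ?thesis
    using e(1)
  proof (cases rule: mem_testE)
    case c: (cell g x y)
    show ?thesis
      using e(2)
    proof (cases rule: mem_testE)
      case c': (cell g' x' y')
      have "g' = g" "y' = y"
        using e(4) c c' node_eq_iff[of y' y g' g] by auto
      moreover have "x = x'"
      proof -
        have "cell_colouring (strand_colour Y g) x y = cell_colouring (strand_colour Y g) x' y"
          using e(3) edge_colour_cell[OF c(2), of Y g] edge_colour_cell[OF c'(2), of Y g']
          unfolding c(5) c'(5) \<open>g' = g\<close> \<open>y' = y\<close> by simp
        then have "cell_colouring (strand_colour Y g) y x = cell_colouring (strand_colour Y g) y x'"
          using cell_colouring_sym by metis
        then show ?thesis by (rule cell_colouring_row)
      qed
      ultimately show ?thesis using c c' by simp
    next
      case up: (up p j)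
      show ?thesis
        using cell_up[OF c(1,2,4) up(1,2)] e(3,4) unfolding c(5) up(3) snd_conv by blast
    next
      case down: (down p j)
      show ?thesis
        using cell_down[OF c(1,2,4) down(1,3)] e(3,4) unfolding c(5) down(4) snd_conv by blast
    qed
  next
    case u: (up p j)
    show ?thesis
      using e(2)
    proof (cases rule: mem_testE)
      case c: (cell g x y)
      show ?thesis
        using cell_up[OF c(1,2,4) u(1,2)] e(3,4) unfolding c(5) u(3) snd_conv by metis
    next
      case u': (up p' j')
      show ?thesis
        using up_up[OF u(1,2) u'(1,2)] e(3,4) unfolding u(3) u'(3) by simp
    next
      case d: (down p' j')
      show ?thesis
        using up_down[OF u(1,2) d(1-3)] e(4) unfolding u(3) d(4) by blast
    qed
  next
    case d: (down p j)
    show ?thesis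
      using e(2)
    proof (cases rule: mem_testE)
      case c: (cell g x y)
      show ?thesis
        using cell_down[OF c(1,2,4) d(1,3)] e(3,4) unfolding c(5) d(4) snd_conv by metis
    next
      case u: (up p' j')
      show ?thesis
        using up_down[OF u(1,2) d(1-3)] e(4) unfolding u(3) d(4) by metis
    next
      case d': (down p' j')
      then have "gid p j = gid p' j'" using e(4) d by (simp add: down_def)
      then show ?thesis using d d' by simp
    qed
  qed
qed

end

definition opt_cache :: "(nat \<Rightarrow> nat) \<Rightarrow> edge set \<Rightarrow> cache" where
  "opt_cache Y E = colour_classes k (edge_colour Y) E"

lemma opt_cache:
  assumes "\<And>t. Y t < 2 ^ l" "s < J" "E = test Y s b \<or> E = neutral Y s"
  shows "is_cache n k (opt_cache Y E)" "cached (opt_cache Y E) = E"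
proof -
  have sub: "E \<subseteq> test Y s b"
    using assms(3) neutral_subset_test by auto
  then show "is_cache n k (opt_cache Y E)"
    unfolding opt_cache_def
    using test_subset_edges[where Y = Y and b = b, OF assms(2,1)]
      proper_fst[where Y = Y and b = b, OF assms(1,2)] proper_snd[where Y = Y and b = b, OF assms(1,2)]
    by (intro is_cache_colour_classes) blast+
  show "cached (opt_cache Y E) = E"
    unfolding opt_cache_def using sub edge_colour_less[where Y = Y and b = b, OF assms(1,2)]
    by (intro cached_colour_classes) blast
qed

end

lemma card_multiples:
  assumes "s \<le> J"
  shows "card {p :: nat. p < 2 ^ J \<and> 2 ^ s dvd p} \<le> 2 ^ (J - s)"
proof -
  have J: "(2 :: nat) ^ J = 2 ^ s * 2 ^ (J - s)" using assms by (simp flip: power_add)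
  have "{p :: nat. p < 2 ^ J \<and> 2 ^ s dvd p} \<subseteq> (\<lambda>i. 2 ^ s * i) ` {..<2 ^ (J - s)}"
    by (auto simp: J elim!: dvdE)
  then have "card {p :: nat. p < 2 ^ J \<and> 2 ^ s dvd p} \<le> card {..<(2 :: nat) ^ (J - s)}"
    by (intro surj_card_le) auto
  then show ?thesis by simp
qed

lemma card_multiples_Suc:
  assumes "s \<le> J"
  shows "card {p. p < 2 ^ J \<and> 2 ^ s dvd Suc p} \<le> 2 ^ (J - s)"
proof -
  have J: "(2 :: nat) ^ J = 2 ^ s * 2 ^ (J - s)" using assms by (simp flip: power_add)
  have "{p. p < 2 ^ J \<and> 2 ^ s dvd Suc p} \<subseteq> (\<lambda>i. 2 ^ s * Suc i - 1) ` {..<2 ^ (J - s)}"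
  proof (rule subsetI, clarify)
    fix p :: nat assume p: "p < 2 ^ J" "2 ^ s dvd Suc p"
    then obtain i where i: "Suc p = 2 ^ s * i" by (auto elim: dvdE)
    then obtain i' where i': "i = Suc i'" by (cases i) auto
    have "2 ^ s * i \<le> 2 ^ s * 2 ^ (J - s)" using p(1) i J by linarith
    then have "i \<le> 2 ^ (J - s)" by simp
    then have "i' < 2 ^ (J - s)" by (simp add: i')
    moreover have "p = 2 ^ s * Suc i' - 1" using i i' by (metis diff_Suc_1)
    ultimately show "p \<in> (\<lambda>i. 2 ^ s * Suc i - 1) ` {..<2 ^ (J - s)}" by blast
  qed
  then have "card {p. p < 2 ^ J \<and> 2 ^ s dvd Suc p} \<le> card {..<(2 :: nat) ^ (J - s)}"
    by (intro surj_card_le) auto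
  then show ?thesis by simp
qed

section \<open>The offline cost of a phase\<close>

context construction
begin

text \<open>The neutral stage before each test provides the common cache from which both values of
  the bit are played. Offline it is free after a test, by
  \<open>neutral_subset_test\<close>.\<close>

primrec level_stages :: "(nat \<Rightarrow> nat) \<Rightarrow> nat \<Rightarrow> nat \<Rightarrow> edge set list" where
  "level_stages Y s 0 = []"
| "level_stages Y s (Suc b) = level_stages Y s b @ [neutral Y s, test Y s b]"

primrec phase_stages :: "(nat \<Rightarrow> nat) \<Rightarrow> nat \<Rightarrow> edge set list" where
  "phase_stages Y 0 = []"
| "phase_stages Y (Suc i) = phase_stages Y i @ level_stages Y (s0 + i) l"

lemma set_level_stages: "E \<in> set (level_stages Y s b) \<Longrightarrow> E = neutral Y s \<or> (\<exists>c. E = test Y s c)"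
  by (induction b) auto

lemma set_phase_stages:
  "E \<in> set (phase_stages Y i) \<Longrightarrow> \<exists>s<s0 + i. E = neutral Y s \<or> (\<exists>c. E = test Y s c)"
  by (induction i) (auto dest!: set_level_stages intro: less_SucI)

lemma finite_gadgets [simp]: "finite gadgets"
  by (simp add: gadgets_def)

lemma finite_neutral [simp]: "finite (neutral Y s)"
  by (simp add: neutral_def)

lemma finite_test [simp]: "finite (test Y s b)"
  by (simp add: test_def)

lemma card_image_strands:
  assumes "card P \<le> m" "finite P"
  shows "card (f ` (P \<times> {..<K})) \<le> m * K"
proof -
  have "card (f ` (P \<times> {..<K})) \<le> card (P \<times> {..<K})"
    using assms(2) by (intro card_image_le) simp
  also have "\<dots> \<le> m * K"
    unfolding card_cartesian_product using assms(1) by simp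
  finally show ?thesis .
qed

lemma card_test_diff:
  assumes "s < J"
  shows "card (test Y s b - neutral Y s) \<le> 2 ^ (J - s) * K"
proof -
  let ?D = "(\<lambda>(p, j). down Y s b p j) ` ({p. p < 2 ^ J \<and> 2 ^ s dvd Suc p} \<times> {..<K})"
  have "card (test Y s b - neutral Y s) \<le> card ?D"
    by (intro card_mono) (auto simp: test_def)
  also have "\<dots> \<le> 2 ^ (J - s) * K"
    using assms by (intro card_image_strands card_multiples_Suc) auto
  finally show ?thesis .
qed

text \<open>If \<open>p\<close> is not the first bundle of its block, the merge shifts the labels of
  \<open>p\<close> and \<open>p - 1\<close> alike, so their link survives.\<close>

lemma up_Suc:
  assumes "\<not> 2 ^ s dvd p"
  shows "up Y (Suc s) p j = up Y s p j"
proof -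
  obtain p' where p: "p = Suc p'" using assms by (cases p) auto
  have "\<not> 2 ^ Suc s dvd p"
    using assms by (metis dvd_mult_right power_Suc)
  moreover have "p div 2 ^ s = p' div 2 ^ s"
    using assms by (simp add: p div_Suc dvd_eq_mod_eq_0)
  then have "label_offset Y (Suc s) p XOR label_offset Y s p = label_offset Y (Suc s) p' XOR label_offset Y s p'"
    by (rule label_offset_high) simp
  then have "label_offset Y (Suc s) p XOR label_offset Y (Suc s) p' = label_offset Y s p XOR label_offset Y s p'"
    by (metis xor.assoc xor.commute xor_cancel(1))
  ultimately show ?thesis
    using assms unfolding up_def by (simp only: p diff_Suc_1 if_False)
qed

text \<open>By \<open>up_Suc\<close> only the first bundles of the level \<open>s\<close> blocks can
  get new \<open>up\<close> edges.\<close>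

lemma card_neutral_diff:
  assumes "s < J" "neutral Y s \<subseteq> E"
  shows "card (neutral Y (Suc s) - E) \<le> 2 ^ (J - s) * K"
proof -
  let ?U = "(\<lambda>(p, j). up Y (Suc s) p j) ` ({p. p < 2 ^ J \<and> 2 ^ s dvd p} \<times> {..<K})"
  have "neutral Y (Suc s) - E \<subseteq> ?U"
  proof
    fix e assume e: "e \<in> neutral Y (Suc s) - E"
    then have "e \<notin> gadgets" using assms(2) by (auto simp: neutral_def)
    then obtain p j where pj: "p < 2 ^ J" "j < K" "e = up Y (Suc s) p j"
      using e by (auto simp: neutral_def)
    have "up Y s p j \<in> E"
      using assms(2) pj by (auto simp: neutral_def)
    then have "2 ^ s dvd p" using e pj(3) up_Suc[of s p Y j] by (metis DiffD2)
    then show "e \<in> ?U" using pj by force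
  qed
  then have "card (neutral Y (Suc s) - E) \<le> card ?U"
    by (intro card_mono) auto
  also have "\<dots> \<le> 2 ^ (J - s) * K"
    using assms by (intro card_image_strands card_multiples) auto
  finally show ?thesis .
qed

lemma step_cost_opt_cache: "finite E' \<Longrightarrow> step_cost k (opt_cache Y E) (opt_cache Y E') \<le> card (E' - E)"
  using step_cost_colour_classes[of E' k "edge_colour Y" E "edge_colour Y"]
  by (simp add: opt_cache_def set_diff_eq cong: conj_cong)

lemma last_level_stages [simp]: "last (C # map f (level_stages Y s (Suc b))) = f (test Y s b)"
  by simp

lemma walk_level:
  assumes "s < J" "0 < b"
  shows "walk_cost k C (map (opt_cache Y) (level_stages Y s b))
    \<le> step_cost k C (opt_cache Y (neutral Y s)) + b * (2 ^ (J - s) * K)"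
  using assms(2)
proof (induction b rule: nat_induct_non_zero)
  case 1
  have "step_cost k (opt_cache Y (neutral Y s)) (opt_cache Y (test Y s 0)) \<le> 2 ^ (J - s) * K"
    using step_cost_opt_cache[of "test Y s 0" Y "neutral Y s"] card_test_diff[OF assms(1), of Y 0] by simp
  then show ?case by simp
next
  case (Suc b)
  then obtain b' where b: "b = Suc b'" by (cases b) auto
  have "step_cost k (opt_cache Y (test Y s b')) (opt_cache Y (neutral Y s)) \<le> card (neutral Y s - test Y s b')"
    by (rule step_cost_opt_cache) simp
  also have "neutral Y s - test Y s b' = {}" using neutral_subset_test by auto
  finally have "step_cost k (opt_cache Y (test Y s b')) (opt_cache Y (neutral Y s)) = 0" by simp
  moreover have "step_cost k (opt_cache Y (neutral Y s)) (opt_cache Y (test Y s b)) \<le> 2 ^ (J - s) * K"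
    using step_cost_opt_cache[of "test Y s b" Y "neutral Y s"] card_test_diff[OF assms(1), of Y b] by simp
  moreover have "walk_cost k C (map (opt_cache Y) (level_stages Y s (Suc b)))
      = walk_cost k C (map (opt_cache Y) (level_stages Y s b))
        + (step_cost k (opt_cache Y (test Y s b')) (opt_cache Y (neutral Y s))
        + step_cost k (opt_cache Y (neutral Y s)) (opt_cache Y (test Y s b)))"
    using last_level_stages[of C "opt_cache Y" Y s b'] unfolding b
    by (subst level_stages.simps(2)) (simp only: map_append walk_cost_append, simp)
  ultimately show ?case using Suc.IH by simp
qed

lemma last_Cons_append: "last (C # xs @ ys) = last (last (C # xs) # ys)"
  by (cases ys) auto

lemma last_phase_stages:
  "last (C # map f (phase_stages Y (Suc i))) = f (test Y (s0 + i) (l - 1))"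
proof -
  have "Suc (l - 1) = l" using levels(2) by simp
  then have "last (D # map f (level_stages Y s l)) = f (test Y s (l - 1))" for D s
    using last_level_stages[of D f Y s "l - 1"] by simp
  then show ?thesis by (simp only: phase_stages.simps map_append last_Cons_append)
qed

text \<open>The level costs form a geometric series, whose remainder is the second summand on the left.\<close>

lemma walk_phase:
  assumes "0 < i" "i \<le> J - s0"
  shows "walk_cost k C (map (opt_cache Y) (phase_stages Y i)) + 2 * (l + 2) * K * 2 ^ (J - s0 - i)
    \<le> step_cost k C (opt_cache Y (neutral Y s0)) + 2 * (l + 2) * K * 2 ^ (J - s0)"
  using assms
proof (induction i rule: nat_induct_non_zero)
  case 1
  then obtain d where d: "J - s0 = Suc d" by (cases "J - s0") auto
  have "walk_cost k C (map (opt_cache Y) (level_stages Y s0 l))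
      \<le> step_cost k C (opt_cache Y (neutral Y s0)) + l * (2 ^ (J - s0) * K)"
    using levels by (intro walk_level) auto
  then show ?case by (simp add: d algebra_simps)
next
  case (Suc i)
  then obtain i' where i: "i = Suc i'" by (cases i) auto
  obtain d where d: "J - s0 - i = Suc d" using Suc.prems by (cases "J - s0 - i") auto
  have s: "s0 + i < J" "J - (s0 + i) = Suc d" "J - s0 - Suc i = d" using Suc.prems d by auto
  let ?C = "opt_cache Y (test Y (s0 + i') (l - 1))"
  have "walk_cost k ?C (map (opt_cache Y) (level_stages Y (s0 + i) l))
      \<le> step_cost k ?C (opt_cache Y (neutral Y (s0 + i))) + l * (2 ^ Suc d * K)"
    using walk_level[OF s(1), of l ?C Y] levels(2) unfolding s(2) by simp
  also have "step_cost k ?C (opt_cache Y (neutral Y (s0 + i)))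
      \<le> card (neutral Y (s0 + i) - test Y (s0 + i') (l - 1))"
    by (rule step_cost_opt_cache) simp
  also have "\<dots> \<le> 2 ^ (J - (s0 + i')) * K"
    unfolding i add_Suc_right using s(1) i neutral_subset_test by (intro card_neutral_diff) auto
  also have "J - (s0 + i') = Suc (Suc d)" using s i by auto
  \<comment> \<open>The bound is \<open>(l + 2) * 2 ^ Suc d * K\<close>: \<open>l\<close> tests, and
    the new \<open>up\<close> edges, counted by the blocks of the level below and thus twice as many
    as for one test. This is exactly the drop of the remainder from \<open>2 ^ Suc d\<close> to
    \<open>2 ^ d\<close>.\<close>
  finally have "walk_cost k ?C (map (opt_cache Y) (level_stages Y (s0 + i) l))
      \<le> 2 ^ Suc (Suc d) * K + l * (2 ^ Suc d * K)" by simp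
  moreover have "walk_cost k C (map (opt_cache Y) (phase_stages Y (Suc i)))
      = walk_cost k C (map (opt_cache Y) (phase_stages Y i))
        + walk_cost k ?C (map (opt_cache Y) (level_stages Y (s0 + i) l))"
    using last_phase_stages[of C "opt_cache Y" Y i'] unfolding i
    by (subst phase_stages.simps(2)) (simp only: map_append walk_cost_append)
  moreover have "walk_cost k C (map (opt_cache Y) (phase_stages Y i)) + 2 * (l + 2) * K * 2 ^ Suc d
      \<le> step_cost k C (opt_cache Y (neutral Y s0)) + 2 * (l + 2) * K * 2 ^ (J - s0)"
    using Suc.IH Suc.prems unfolding d by simp
  ultimately show ?case unfolding s(3) by (simp add: algebra_simps)
qed

abbreviation full_phase :: "(nat \<Rightarrow> nat) \<Rightarrow> edge set list" where
  "full_phase Y \<equiv> phase_stages Y (J - s0)"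

text \<open>Here \<open>l <= 2 ^ s0\<close> pays off:
  \<open>2 * (l + 2) <= 2 * 2 ^ s0 + 4 * 2 ^ s0\<close>, so all levels together add at most 6 edges
  per gadget.\<close>

lemma walk_full_phase:
  "walk_cost k C (map (opt_cache Y) (full_phase Y))
    \<le> step_cost k C (opt_cache Y (neutral Y s0)) + 6 * (2 ^ J * K)"
proof -
  have "walk_cost k C (map (opt_cache Y) (full_phase Y))
      \<le> step_cost k C (opt_cache Y (neutral Y s0)) + 2 * (l + 2) * K * 2 ^ (J - s0)"
    using walk_phase[of "J - s0" C Y] levels(1) by simp
  also have "2 * (l + 2) * K * 2 ^ (J - s0) \<le> 6 * 2 ^ s0 * K * 2 ^ (J - s0)"
  proof (intro mult_le_mono1)
    have "2 * (l + 2) = 2 * l + 4" by simp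
    then show "2 * (l + 2) \<le> 6 * 2 ^ s0" using levels by linarith
  qed
  also have "\<dots> = 6 * ((2 ^ s0 * 2 ^ (J - s0)) * K)" by simp
  also have "2 ^ s0 * 2 ^ (J - s0) = (2 :: nat) ^ J"
    using levels(1) by (simp flip: power_add)
  finally show ?thesis by simp
qed

lemma card_recoloured_gadget:
  "card {e \<in> gadget k r g. edge_colour Y e \<noteq> edge_colour Y' e} \<le> 6"
proof -
  let ?a = "strand_colour Y g" and ?a' = "strand_colour Y' g"
  let ?L = "[(?a, ?a), (0, ?a), (?a, 0), (?a', ?a'), (0, ?a'), (?a', 0)]"
  have "{e \<in> gadget k r g. edge_colour Y e \<noteq> edge_colour Y' e}
      \<subseteq> (\<lambda>(x, y). (g * 2 ^ r + x, g * 2 ^ r + y)) ` set ?L"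
  proof (rule subsetI, clarify)
    fix a b assume "(a, b) \<in> gadget k r g" and ne: "edge_colour Y (a, b) \<noteq> edge_colour Y' (a, b)"
    then obtain x y where xy: "(x, y) \<in> cells k r" "(a, b) = (g * 2 ^ r + x, g * 2 ^ r + y)"
      by (auto simp: gadget_def)
    then have "(x, y) \<in> set ?L"
      using ne cell_colouring_diff[of k r ?a ?a'] edge_colour_cell[OF xy(1)] by auto
    with xy(2) show "(a, b) \<in> (\<lambda>(x, y). (g * 2 ^ r + x, g * 2 ^ r + y)) ` set ?L"
      by (intro image_eqI[of _ _ "(x, y)"]) simp_all
  qed
  then have "card {e \<in> gadget k r g. edge_colour Y e \<noteq> edge_colour Y' e} \<le> card (set ?L)"
    by (rule surj_card_le[rotated]) (rule finite_set)
  also have "\<dots> \<le> 6" using card_length[of ?L] by simp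
  finally show ?thesis .
qed

text \<open>Per gadget at most six cells change colour and one \<open>up\<close> edge is new or
  recoloured, which makes 7.\<close>

lemma step_cost_new_phase:
  assumes "gadgets \<subseteq> E"
  shows "step_cost k (opt_cache Y E) (opt_cache Y' (neutral Y' s0)) \<le> 7 * (2 ^ J * K)"
proof -
  let ?U = "(\<lambda>(p, j). up Y' s0 p j) ` ({..<2 ^ J} \<times> {..<K})"
  let ?R = "\<lambda>g. {e \<in> gadget k r g. edge_colour Y e \<noteq> edge_colour Y' e}"
  have "step_cost k (opt_cache Y E) (opt_cache Y' (neutral Y' s0))
      \<le> card {e \<in> neutral Y' s0. \<not> (e \<in> E \<and> edge_colour Y e = edge_colour Y' e)}"
    unfolding opt_cache_def by (rule step_cost_colour_classes) simp
  also have "\<dots> \<le> card (?U \<union> (\<Union>g<2 ^ J * K. ?R g))"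
    using assms by (intro card_mono) (auto simp: neutral_def gadgets_def)
  also have "\<dots> \<le> card ?U + card (\<Union>g<2 ^ J * K. ?R g)"
    by (rule card_Un_le)
  also have "card ?U \<le> 2 ^ J * K"
    by (rule card_image_strands) auto
  also have "card (\<Union>g<2 ^ J * K. ?R g) \<le> (\<Sum>g<2 ^ J * K. card (?R g))"
    by (rule card_UN_le) simp
  also have "\<dots> \<le> (\<Sum>g<2 ^ J * K. 6)"
    by (intro sum_mono card_recoloured_gadget)
  finally show ?thesis by (simp add: mult.commute)
qed

definition opt_walk :: "(nat \<Rightarrow> nat) list \<Rightarrow> cache list" where
  "opt_walk Ys = concat (map (\<lambda>Y. map (opt_cache Y) (full_phase Y)) Ys)"

lemma last_opt_walk: "\<exists>b. last (C # opt_walk (Ys @ [Y])) = opt_cache Y (test Y (J - 1) b)"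
proof -
  obtain i where i: "J - s0 = Suc i" using levels(1) by (cases "J - s0") auto
  then have J: "s0 + i = J - 1" by auto
  have "last (D # map (opt_cache Y) (full_phase Y)) = opt_cache Y (test Y (J - 1) (l - 1))" for D
    unfolding i last_phase_stages J ..
  moreover have "opt_walk (Ys @ [Y]) = opt_walk Ys @ map (opt_cache Y) (full_phase Y)"
    by (simp add: opt_walk_def)
  ultimately show ?thesis by (simp only: last_Cons_append) blast
qed

text \<open>13 is 7 for the change of phase plus 6 within it. Filling the empty cache at the start
  is charged to \<open>card (edges n)\<close>, which later goes into the additive constant.\<close>

lemma walk_opt_walk:
  assumes "\<And>Y t. Y \<in> set Ys \<Longrightarrow> Y t < 2 ^ l"
  shows "walk_cost k (replicate k {}) (opt_walk Ys) \<le> card (edges n) + length Ys * (13 * (2 ^ J * K))"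
  using assms
proof (induction Ys rule: rev_induct)
  case Nil
  show ?case by (simp add: opt_walk_def)
next
  case (snoc Y Ys)
  let ?C = "last (replicate k {} # opt_walk Ys)"
  have walk: "walk_cost k (replicate k {}) (opt_walk (Ys @ [Y]))
      = walk_cost k (replicate k {}) (opt_walk Ys) + walk_cost k ?C (map (opt_cache Y) (full_phase Y))"
    by (simp add: opt_walk_def walk_cost_append)
  show ?case
  proof (cases Ys rule: rev_exhaust)
    case Nil
    have "is_cache n k (opt_cache Y (neutral Y s0))"
      using snoc.prems levels by (intro opt_cache(1)[where s = s0]) auto
    then have "step_cost k (replicate k {}) (opt_cache Y (neutral Y s0)) \<le> card (edges n)"
      by (rule step_cost_from_empty)
    moreover have "walk_cost k (replicate k {}) (opt_walk []) = 0" by (simp add: opt_walk_def)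
    ultimately show ?thesis
      using walk walk_full_phase[of "replicate k {}" Y] Nil by (simp add: opt_walk_def)
  next
    case (snoc Ys' Y')
    obtain b where b: "?C = opt_cache Y' (test Y' (J - 1) b)"
      using last_opt_walk[of "replicate k {}" Ys' Y'] snoc by auto
    have "step_cost k ?C (opt_cache Y (neutral Y s0)) \<le> 7 * (2 ^ J * K)"
      unfolding b by (rule step_cost_new_phase) (auto simp: test_def neutral_def)
    then have "walk_cost k ?C (map (opt_cache Y) (full_phase Y)) \<le> 13 * (2 ^ J * K)"
      using walk_full_phase[of ?C Y] by simp
    then show ?thesis using walk snoc.IH snoc.prems by simp
  qed
qed

definition stage_requests :: "edge set list \<Rightarrow> edge list" where
  "stage_requests Es = concat (map req Es)"

lemma neutral_nonempty: "neutral Y s \<noteq> {}"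
proof -
  have "up Y s 0 0 \<in> neutral Y s"
    using K_pos by (force simp: neutral_def)
  then show ?thesis by blast
qed

lemma opt_cost_phases:
  assumes "\<And>Y t. Y \<in> set Ys \<Longrightarrow> Y t < 2 ^ l"
  shows "opt_cost n k (stage_requests (concat (map full_phase Ys)))
    \<le> card (edges n) + length Ys * (13 * (2 ^ J * K))"
proof -
  define xs where "xs = concat (map (\<lambda>Y. map (\<lambda>E. (req E, opt_cache Y E)) (full_phase Y)) Ys)"
  have "map fst xs = map req (concat (map full_phase Ys))"
    by (simp add: xs_def map_concat comp_def)
  moreover have "map snd xs = opt_walk Ys"
    by (simp add: xs_def opt_walk_def map_concat comp_def)
  moreover have "\<forall>(es, C) \<in> set xs. es \<noteq> [] \<and> is_cache n k C \<and> set es \<subseteq> cached C"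
  proof clarify
    fix es C assume "(es, C) \<in> set xs"
    then obtain Y E where Y: "Y \<in> set Ys" "E \<in> set (full_phase Y)" "es = req E" "C = opt_cache Y E"
      by (auto simp: xs_def)
    then obtain s b where s: "s < J" "E = neutral Y s \<or> E = test Y s b"
      using set_phase_stages levels(1) by fastforce
    have E: "finite E" "E \<noteq> {}"
      using s(2) neutral_nonempty neutral_subset_test by fastforce+
    have "0 < 2 ^ J * K" using K_pos by simp
    with E have "es \<noteq> []" unfolding Y(3) by (intro requests_nonempty)
    moreover have "is_cache n k C" "cached C = E"
      unfolding Y(4) using opt_cache[of Y s E b] assms[OF Y(1)] s by auto
    ultimately show "es \<noteq> [] \<and> is_cache n k C \<and> set es \<subseteq> cached C"
      using set_requests_subset[OF E(1)] Y(3) by simp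
  qed
  ultimately have "opt_cost n k (stage_requests (concat (map full_phase Ys)))
      \<le> walk_cost k (replicate k {}) (opt_walk Ys)"
    using opt_cost_le_walk_cost[of xs n k] by (simp add: stage_requests_def)
  also have "\<dots> \<le> card (edges n) + length Ys * (13 * (2 ^ J * K))"
    using assms by (rule walk_opt_walk)
  finally show ?thesis .
qed

end

section \<open>Phases\<close>

context construction
begin

text \<open>A test sees only bit \<open>b\<close> of \<open>Y s\<close>, so higher bits may be
  decided later without altering the requests already made.\<close>

lemma test_cong:
  assumes "\<And>t. t < s \<Longrightarrow> Y t = Y' t" "bit (Y s) b = bit (Y' s) b"
  shows "test Y s b = test Y' s b"
proof -
  have offset: "label_offset Y s = label_offset Y' s"
    using assms(1) by (intro ext label_offset_cong)
  have "bit (j XOR label_offset Y (Suc s) p) b = bit (j XOR label_offset Y' (Suc s) p) b" for j p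
    using assms(2) by (simp add: offset bit_xor_iff)
  then have "down Y s b = down Y' s b"
    by (intro ext) (simp add: down_def del: label_offset.simps)
  then show ?thesis
    using neutral_cong[OF assms(1)] by (simp add: test_def)
qed

lemma level_stages_cong:
  assumes "\<And>t. t < s \<Longrightarrow> Y t = Y' t" "\<And>c. c < b \<Longrightarrow> bit (Y s) c = bit (Y' s) c"
  shows "level_stages Y s b = level_stages Y' s b"
  using assms(2)
proof (induction b)
  case (Suc b)
  then show ?case
    using neutral_cong[of s Y Y'] test_cong[of s Y Y' b] assms(1) by simp
qed simp

lemma phase_stages_cong:
  assumes "\<And>t. t < s0 + i \<Longrightarrow> Y t = Y' t"
  shows "phase_stages Y i = phase_stages Y' i"
  using assms
proof (induction i)
  case (Suc i)
  then show ?case using level_stages_cong[of "s0 + i" Y Y' l] by simp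
qed simp

lemma stage_requests_append: "stage_requests (Es @ Fs) = stage_requests Es @ stage_requests Fs"
  by (simp add: stage_requests_def)

lemma stage_requests_in_lists:
  assumes "\<And>E. E \<in> set Es \<Longrightarrow> E \<subseteq> edges n"
  shows "stage_requests Es \<in> lists (edges n)"
proof -
  have "set (req E) \<subseteq> edges n" if "E \<in> set Es" for E
    using set_requests_subset[OF finite_subset[OF assms[OF that] finite_edges]] assms[OF that] by blast
  then show ?thesis by (auto simp: stage_requests_def in_lists_conv_set)
qed

lemma level_requests_in_lists:
  assumes "s < J" "\<And>t. Y t < 2 ^ l"
  shows "stage_requests (level_stages Y s b) \<in> lists (edges n)"
  using set_level_stages test_subset_edges[where Y = Y, OF assms] neutral_subset_edges[where Y = Y, OF assms]
  by (intro stage_requests_in_lists) blast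

lemma phase_requests_in_lists:
  assumes "i \<le> J - s0" "\<And>t. Y t < 2 ^ l"
  shows "stage_requests (phase_stages Y i) \<in> lists (edges n)"
proof (rule stage_requests_in_lists)
  fix E assume "E \<in> set (phase_stages Y i)"
  then obtain s where "s < s0 + i" "E = neutral Y s \<or> (\<exists>c. E = test Y s c)"
    using set_phase_stages by blast
  moreover from this(1) have "s < J" using assms(1) levels(1) by linarith
  ultimately show "E \<subseteq> edges n"
    using test_subset_edges[where Y = Y, OF _ assms(2)] neutral_subset_edges[where Y = Y, OF _ assms(2)]
    by blast
qed

context
  fixes D :: "det_alg measure"
  assumes D: "randomized_online_alg n k D"
begin

text \<open>With \<open>y < 2 ^ b\<close> bit \<open>b\<close> is still open: \<open>y\<close> and
  \<open>y XOR 2 ^ b\<close> produce the same earlier stages, and for one of them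
  \<open>choose_continuation\<close> adds an eighth of the number of gadgets in expectation.\<close>

lemma adversary_level:
  assumes \<sigma>: "\<sigma> \<in> lists (edges n)" and Y: "\<And>t. Y t < 2 ^ l" and s: "s < J" and b: "b \<le> l"
  shows "\<exists>y<2 ^ b. expected_cost k D \<sigma> + real b * (real (2 ^ J * K) / 8)
    \<le> expected_cost k D (\<sigma> @ stage_requests (level_stages (Y(s := y)) s b))"
  using b
proof (induction b)
  case 0
  show ?case by (simp add: stage_requests_def)
next
  case (Suc b)
  then obtain y where y: "y < 2 ^ b" and cost: "expected_cost k D \<sigma> + real b * (real (2 ^ J * K) / 8)
      \<le> expected_cost k D (\<sigma> @ stage_requests (level_stages (Y(s := y)) s b))"
    using Suc_leD by blast
  let ?y' = "y XOR 2 ^ b"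
  let ?\<sigma> = "\<sigma> @ stage_requests (level_stages (Y(s := y)) s b)"
  let ?\<tau> = "\<lambda>y. req (neutral Y s) @ req (test (Y(s := y)) s b)"
  have y': "?y' < 2 ^ Suc b" using y by (intro xor_less_power) auto
  have pow: "(2 :: nat) ^ Suc b \<le> 2 ^ l" using Suc.prems by (intro power_increasing) auto
  have less: "y < 2 ^ l" "?y' < 2 ^ l" using y y' pow by auto
  have bit_y: "\<not> bit y b"
    using y by (simp add: bit_iff_odd)
  then have bit_y': "bit ?y' b"
    by (simp add: bit_flip)
  have stages: "stage_requests (level_stages (Y(s := z)) s (Suc b))
      = stage_requests (level_stages (Y(s := y)) s b) @ ?\<tau> z" if "z = y \<or> z = ?y'" for z
  proof -
    have "level_stages (Y(s := z)) s b = level_stages (Y(s := y)) s b"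
      using that by (intro level_stages_cong) (auto simp: bit_flip)
    moreover have "neutral (Y(s := z)) s = neutral Y s"
      by (rule neutral_cong) simp
    ultimately show ?thesis by (simp add: stage_requests_def)
  qed
  have lists: "\<sigma> @ stage_requests (level_stages (Y(s := z)) s c) \<in> lists (edges n)" if "z < 2 ^ l" for z c
    using \<sigma> level_requests_in_lists[OF s, of "Y(s := z)" c] Y that by simp
  have "expected_cost k D ?\<sigma> + real (2 ^ J * K) / 8 \<le> expected_cost k D (?\<sigma> @ ?\<tau> y) \<or>
      expected_cost k D ?\<sigma> + real (2 ^ J * K) / 8 \<le> expected_cost k D (?\<sigma> @ ?\<tau> ?y')"
  proof (rule choose_continuation[OF D])
    show "?\<sigma> \<in> lists (edges n)" using less(1) by (rule lists)
    show "?\<sigma> @ ?\<tau> y \<in> lists (edges n)" "?\<sigma> @ ?\<tau> ?y' \<in> lists (edges n)"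
      using lists[OF less(1), of "Suc b"] lists[OF less(2), of "Suc b"] stages[of y] stages[of ?y'] by simp_all
    fix A assume "det_online_alg n k A"
    then show "8 * alg_cost k A ?\<sigma> + 2 ^ J * K
        \<le> 4 * (alg_cost k A (?\<sigma> @ ?\<tau> y) + alg_cost k A (?\<sigma> @ ?\<tau> ?y'))"
      using lists[OF less(1), of b] bit_y bit_y' less Y s by (intro adversary_det) auto
  qed
  then obtain z where z: "z = y \<or> z = ?y'"
    "expected_cost k D ?\<sigma> + real (2 ^ J * K) / 8 \<le> expected_cost k D (?\<sigma> @ ?\<tau> z)" by blast
  have "z < 2 ^ Suc b" using z(1) y y' by auto
  moreover have "expected_cost k D \<sigma> + real (Suc b) * (real (2 ^ J * K) / 8)
      \<le> expected_cost k D (\<sigma> @ stage_requests (level_stages (Y(s := z)) s (Suc b)))"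
  proof -
    have eq: "\<sigma> @ stage_requests (level_stages (Y(s := z)) s (Suc b)) = ?\<sigma> @ ?\<tau> z"
      by (simp only: stages[OF z(1)] append_assoc)
    have "real (Suc b) * (real (2 ^ J * K) / 8) = real b * (real (2 ^ J * K) / 8) + real (2 ^ J * K) / 8"
      by (simp only: of_nat_Suc distrib_right mult_1 add.commute)
    then show ?thesis unfolding eq using cost z(2) by linarith
  qed
  ultimately show ?case by blast
qed

lemma adversary_phase:
  assumes \<sigma>: "\<sigma> \<in> lists (edges n)" and i: "i \<le> J - s0"
  shows "\<exists>Y. (\<forall>t. Y t < 2 ^ l) \<and> expected_cost k D \<sigma> + real (i * l) * (real (2 ^ J * K) / 8)
    \<le> expected_cost k D (\<sigma> @ stage_requests (phase_stages Y i))"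
  using i
proof (induction i)
  case 0
  show ?case by (intro exI[of _ "\<lambda>_. 0"]) (simp add: stage_requests_def)
next
  case (Suc i)
  then obtain Y where Y: "\<And>t. Y t < 2 ^ l" and cost: "expected_cost k D \<sigma> + real (i * l) * (real (2 ^ J * K) / 8)
      \<le> expected_cost k D (\<sigma> @ stage_requests (phase_stages Y i))"
    using Suc_leD by blast
  have s: "s0 + i < J" using Suc.prems levels(1) by linarith
  have i: "i \<le> J - s0" using Suc.prems by linarith
  have "\<sigma> @ stage_requests (phase_stages Y i) \<in> lists (edges n)"
    using \<sigma> phase_requests_in_lists[where Y = Y, OF i Y] by simp
  from adversary_level[where Y = Y, OF this Y s order_refl] obtain y where y: "y < 2 ^ l"
    "expected_cost k D (\<sigma> @ stage_requests (phase_stages Y i)) + real l * (real (2 ^ J * K) / 8)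
      \<le> expected_cost k D ((\<sigma> @ stage_requests (phase_stages Y i))
          @ stage_requests (level_stages (Y(s0 + i := y)) (s0 + i) l))" by blast
  let ?Y = "Y(s0 + i := y)"
  have "phase_stages ?Y i = phase_stages Y i"
    by (rule phase_stages_cong) simp
  then have "stage_requests (phase_stages ?Y (Suc i))
      = stage_requests (phase_stages Y i) @ stage_requests (level_stages ?Y (s0 + i) l)"
    by (simp add: stage_requests_append)
  then have eq: "\<sigma> @ stage_requests (phase_stages ?Y (Suc i))
      = (\<sigma> @ stage_requests (phase_stages Y i)) @ stage_requests (level_stages ?Y (s0 + i) l)"
    by (simp only: append_assoc)
  have "real (Suc i * l) * (real (2 ^ J * K) / 8)
      = real (i * l) * (real (2 ^ J * K) / 8) + real l * (real (2 ^ J * K) / 8)"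
    by (simp only: mult_Suc of_nat_add distrib_right add.commute)
  then have "expected_cost k D \<sigma> + real (Suc i * l) * (real (2 ^ J * K) / 8)
      \<le> expected_cost k D (\<sigma> @ stage_requests (phase_stages ?Y (Suc i)))"
    unfolding eq using cost y(2) by linarith
  moreover have "\<forall>t. ?Y t < 2 ^ l" using Y y(1) by simp
  ultimately show ?case by blast
qed

lemma adversary_phases:
  "\<exists>Ys. length Ys = P \<and> (\<forall>Y\<in>set Ys. \<forall>t. Y t < 2 ^ l) \<and>
    stage_requests (concat (map full_phase Ys)) \<in> lists (edges n) \<and>
    real P * (real ((J - s0) * l) * (real (2 ^ J * K) / 8))
      \<le> expected_cost k D (stage_requests (concat (map full_phase Ys)))"
proof (induction P)
  case 0
  show ?case
    by (simp add: stage_requests_def expected_cost_def schedule_cost_def)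
next
  case (Suc P)
  then obtain Ys where Ys: "length Ys = P" "\<forall>Y\<in>set Ys. \<forall>t. Y t < 2 ^ l"
    "stage_requests (concat (map full_phase Ys)) \<in> lists (edges n)"
    "real P * (real ((J - s0) * l) * (real (2 ^ J * K) / 8))
      \<le> expected_cost k D (stage_requests (concat (map full_phase Ys)))" by blast
  from adversary_phase[OF Ys(3) order_refl] obtain Y where Y: "\<And>t. Y t < 2 ^ l"
    "expected_cost k D (stage_requests (concat (map full_phase Ys))) + real ((J - s0) * l) * (real (2 ^ J * K) / 8)
      \<le> expected_cost k D (stage_requests (concat (map full_phase Ys)) @ stage_requests (full_phase Y))" by blast
  have eq: "stage_requests (concat (map full_phase (Ys @ [Y])))
      = stage_requests (concat (map full_phase Ys)) @ stage_requests (full_phase Y)"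
    by (simp add: stage_requests_append)
  have "real (Suc P) * (real ((J - s0) * l) * (real (2 ^ J * K) / 8))
      = real P * (real ((J - s0) * l) * (real (2 ^ J * K) / 8)) + real ((J - s0) * l) * (real (2 ^ J * K) / 8)"
    by (simp add: distrib_right)
  with Ys(4) Y(2) have "real (Suc P) * (real ((J - s0) * l) * (real (2 ^ J * K) / 8))
      \<le> expected_cost k D (stage_requests (concat (map full_phase (Ys @ [Y]))))"
    unfolding eq by linarith
  moreover have "stage_requests (concat (map full_phase (Ys @ [Y]))) \<in> lists (edges n)"
    unfolding eq using Ys(3) phase_requests_in_lists[where Y = Y, OF order_refl Y(1)] by simp
  ultimately show ?case
    using Ys(1,2) Y(1) by (intro exI[of _ "Ys @ [Y]"]) auto
qed

text \<open>Per gadget a phase costs at least \<open>(J - s0) * l / 8\<close> online and at most 13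
  offline, and \<open>8 * 13 = 104\<close>. The number \<open>P\<close> of phases is arbitrary, so
  additive terms vanish.\<close>

lemma competitive_ge:
  assumes c: "competitive n k c D" "0 \<le> c"
  shows "real ((J - s0) * l) / 104 \<le> c"
proof -
  define M where "M = real (2 ^ J * K)"
  define N where "N = real (card (edges n))"
  have M: "0 < M" using K_pos by (simp add: M_def)
  from c(1) obtain d where d: "\<And>\<sigma>. \<sigma> \<in> lists (edges n) \<Longrightarrow> expected_cost k D \<sigma> \<le> c * real (opt_cost n k \<sigma>) + d"
    by (auto simp: competitive_def)
  have bound: "real P * (real ((J - s0) * l) * (M / 8) - c * (13 * M)) \<le> c * N + d" for P
  proof -
    obtain Ys where Ys: "length Ys = P" "\<forall>Y\<in>set Ys. \<forall>t. Y t < 2 ^ l"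
      "stage_requests (concat (map full_phase Ys)) \<in> lists (edges n)"
      "real P * (real ((J - s0) * l) * (M / 8)) \<le> expected_cost k D (stage_requests (concat (map full_phase Ys)))"
      using adversary_phases[of P] unfolding M_def by blast
    let ?\<sigma> = "stage_requests (concat (map full_phase Ys))"
    have "opt_cost n k ?\<sigma> \<le> card (edges n) + length Ys * (13 * (2 ^ J * K))"
      using Ys(2) by (intro opt_cost_phases) auto
    then have "real (opt_cost n k ?\<sigma>) \<le> real (card (edges n) + length Ys * (13 * (2 ^ J * K)))"
      by (rule of_nat_mono)
    also have "\<dots> = N + real P * (13 * M)"
      by (simp add: Ys(1) M_def N_def)
    finally have "c * real (opt_cost n k ?\<sigma>) \<le> c * (N + real P * (13 * M))"
      using c(2) by (rule mult_left_mono)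
    with Ys(4) d[OF Ys(3)] show ?thesis by (simp add: algebra_simps)
  qed
  have "real ((J - s0) * l) * (M / 8) - c * (13 * M) \<le> 0"
  proof (rule ccontr)
    assume "\<not> ?thesis"
    then obtain P where "c * N + d < real P * (real ((J - s0) * l) * (M / 8) - c * (13 * M))"
      using reals_Archimedean3 not_le by blast
    with bound[of P] show False by simp
  qed
  then have "M * (real ((J - s0) * l) / 8) \<le> M * (13 * c)" by (simp add: algebra_simps)
  then have "real ((J - s0) * l) / 8 \<le> 13 * c" using M by simp
  then show ?thesis by simp
qed

end

end

section \<open>Small cases and the choice of parameters\<close>

lemma star_not_cached:
  assumes "is_cache n k C"
  shows "\<not> {0} \<times> {..k} \<subseteq> cached C"
proof
  assume sub: "{0} \<times> {..k} \<subseteq> cached C"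
  then have "\<forall>v\<in>{..k}. \<exists>c<k. (0, v) \<in> C ! c"
    using mem_cached_iff[OF assms] by blast
  then obtain f where f: "\<And>v. v \<le> k \<Longrightarrow> f v < k \<and> (0, v) \<in> C ! f v"
    by (metis atMost_iff)
  have "inj_on f {..k}"
    by (rule inj_onI) (metis assms atMost_iff cache_same_fst f)
  moreover have "f ` {..k} \<subseteq> {..<k}" using f by auto
  ultimately have "card {..k} \<le> card {..<k}"
    by (intro card_inj_on_le) auto
  then show False by simp
qed

text \<open>A star of \<open>k + 1\<close> edges never fits into a cache, so repeating it makes the
  optimum unbounded, and no algorithm beats the optimum. This covers the parameters for which the
  gadgets give nothing and supplies \<open>0 <= c\<close>.\<close>

lemma competitive_ge_1:
  assumes D: "randomized_online_alg n k D" and k: "k < n" and c: "competitive n k c D"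
  shows "1 \<le> c"
proof (rule ccontr)
  assume "\<not> 1 \<le> c"
  then have c1: "0 < 1 - c" by simp
  from c obtain d where d: "\<And>\<sigma>. \<sigma> \<in> lists (edges n) \<Longrightarrow> expected_cost k D \<sigma> \<le> c * real (opt_cost n k \<sigma>) + d"
    by (auto simp: competitive_def)
  obtain P where P: "d < real P * (1 - c)"
    using reals_Archimedean3[OF c1] by blast
  let ?E = "{0 :: nat} \<times> {..k}"
  have E: "?E \<subseteq> edges n" using k by (auto simp: edges_def)
  obtain es where es: "set es = ?E" "requests P ?E = concat (replicate P es)"
    using requests_block[of ?E P] by blast
  let ?\<sigma> = "requests P ?E"
  have \<sigma>: "?\<sigma> \<in> lists (edges n)"
    using set_requests_subset[of ?E P] E by (auto simp: in_lists_conv_set)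
  have len: "length ?\<sigma> = P * length es" by (simp add: es length_concat_replicate)
  have "P \<le> schedule_cost k ?\<sigma> S" if S: "feasible n k ?\<sigma> S" for S
  proof -
    have "feasible n k ([] @ concat (replicate P es) @ []) S"
      using S by (simp add: es(2))
    from repeated_block[OF this] show ?thesis
      using star_not_cached[of n k] S len es(1)
      by (auto simp: schedule_cost_eq_segment feasible_def)
  qed
  moreover have "\<exists>S. feasible n k ?\<sigma> S"
  proof -
    obtain A where "A \<in> space D"
      using D prob_space.not_empty[of D] by (auto simp: randomized_online_alg_def)
    then show ?thesis using online[OF D] \<sigma> by (auto simp: det_online_alg_def)
  qed
  ultimately have "P \<le> opt_cost n k ?\<sigma>"
    unfolding opt_cost_def by (intro cInf_greatest) auto
  then have "real P * (1 - c) \<le> real (opt_cost n k ?\<sigma>) * (1 - c)"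
    using c1 by (intro mult_right_mono) auto
  moreover have "real (opt_cost n k ?\<sigma>) \<le> c * real (opt_cost n k ?\<sigma>) + d"
    using opt_cost_le_expected_cost[OF D \<sigma>] d[OF \<sigma>] by linarith
  ultimately show False using P by (simp add: algebra_simps)
qed

lemma ex_power_of_two_between:
  fixes m :: nat
  assumes "1 \<le> m"
  shows "\<exists>s. m \<le> 2 ^ s \<and> 2 ^ s \<le> 2 * m"
proof (cases "m = 1")
  case True
  then show ?thesis by (intro exI[of _ 0]) simp
next
  case False
  then obtain i where "2 ^ i < m" "m \<le> 2 ^ (i + 1)"
    using ex_power_ivl2[of 2 m] assms by auto
  then show ?thesis by (intro exI[of _ "i + 1"]) simp
qed

text \<open>The factor 6 is 2 from rounding \<open>l\<close> up to \<open>2 ^ s0\<close> times 3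
  from \<open>K * 2 ^ r + 1 <= 3 * k\<^sup>2\<close>. Rounding \<open>k\<close> down to a multiple
  of \<open>2 ^ l\<close> loses at most a third if \<open>3 * 2 ^ l <= k\<close>, and also if
  \<open>l = 1\<close>, where \<open>k = 3\<close> is tight.\<close>

lemma competitive_ge_levels:
  assumes D: "randomized_online_alg n k D" and k: "2 \<le> k" "k < n" and c: "competitive n k c D"
    and l: "1 \<le> l" "l = 1 \<or> 3 * 2 ^ l \<le> k" and m: "1 \<le> m" "6 * l * k\<^sup>2 * 2 ^ m \<le> n"
  shows "real (m * l) / 104 \<le> c"
proof -
  define K where "K = 2 ^ l * (k div 2 ^ l)"
  obtain s0 where s0: "l \<le> 2 ^ s0" "2 ^ s0 \<le> 2 * l"
    using ex_power_of_two_between[OF l(1)] by blast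
  obtain r where r: "k \<le> 2 ^ r" "2 ^ r \<le> 2 * k"
    using ex_power_of_two_between[of k] k by auto
  have K: "k = K + k mod 2 ^ l" "K \<le> k"
    by (simp_all add: K_def)
  have "2 * k \<le> 3 * K"
  proof (cases "3 * 2 ^ l \<le> k")
    case True
    have "k mod 2 ^ l < 2 ^ l" by simp
    then show ?thesis using True K(1) by linarith
  next
    case False
    then have "l = 1" using l(2) by simp
    then have "k = K + k mod 2" using K(1) by simp
    then show ?thesis
      using k(1) by (cases "k = 2") (simp, presburger)
  qed
  moreover have "2 ^ (s0 + m) * K * 2 ^ r + 2 ^ (s0 + m) \<le> n"
  proof -
    have "K * 2 ^ r + 1 \<le> k * (2 * k) + k * k"
      using K(2) r(2) k(1) by (intro add_mono mult_le_mono) auto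
    then have "2 ^ (s0 + m) * (K * 2 ^ r + 1) \<le> (2 * l * 2 ^ m) * (3 * k\<^sup>2)"
      unfolding power_add using s0(2) by (intro mult_le_mono) (auto simp: power2_eq_square)
    also have "\<dots> = 6 * l * k\<^sup>2 * 2 ^ m" by simp
    finally show ?thesis using m(2) by (simp add: algebra_simps)
  qed
  moreover have "0 \<le> c" using competitive_ge_1[OF D k(2) c] by simp
  ultimately interpret construction n k l "k div 2 ^ l" r "s0 + m" s0 K
    using k(1) r(1) K(2) l(1) s0(1) m(1) by unfold_locales (auto simp: K_def)
  show ?thesis using competitive_ge[OF D c \<open>0 \<le> c\<close>] by simp
qed

unbundle no bit_operations_syntax

theorem theorem9:
  "\<exists>C::real. C > 0 \<and>
     (\<forall>(n::nat) (k::nat) (D::det_alg measure).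
        2 \<le> k \<longrightarrow> k < n \<longrightarrow> randomized_online_alg n k D \<longrightarrow>
        ereal (C * (log 2 (real n / ((real k)\<^sup>2 * log 2 (real k))) * log 2 (real k)))
          \<le> competitive_ratio n k D)"
proof (intro exI[of _ "1 / 20000"] conjI allI impI)
  fix n k :: nat and D :: "det_alg measure"
  assume k: "2 \<le> k" "k < n" and D: "randomized_online_alg n k D"
  define L where "L = log 2 (real k)"
  define X where "X = real n / ((real k)\<^sup>2 * L)"
  define x where "x = log 2 X"
  have L: "1 \<le> L" using k(1) by (simp add: L_def)
  have k_powr: "real k = 2 powr L" using k(1) by (simp add: L_def)
  have X: "0 < X" unfolding X_def using k L by (intro divide_pos_pos mult_pos_pos) auto
  have X_powr: "X = 2 powr x" using X by (simp add: x_def)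
  have n: "real n = X * (real k)\<^sup>2 * L" unfolding X_def using k L by simp
  \<comment> \<open>\<open>a\<close> is the slack between \<open>m\<close> and \<open>x\<close>: it
    may be positive when \<open>l\<close> is a small fraction of \<open>L\<close>, and has to be
    negative when \<open>l\<close> is close to \<open>L\<close>.\<close>
  have nodes: "6 * l * k\<^sup>2 * 2 ^ m \<le> n" if "real m \<le> x + a" "6 * real l * 2 powr a \<le> L" for l m :: nat and a :: real
  proof -
    have "(2 :: real) ^ m = 2 powr real m" by (simp add: powr_realpow)
    also have "\<dots> \<le> 2 powr (x + a)" using that(1) by simp
    also have "\<dots> = X * 2 powr a" by (simp add: powr_add X_powr)
    finally have "6 * real l * (real k)\<^sup>2 * 2 ^ m \<le> 6 * real l * (real k)\<^sup>2 * (X * 2 powr a)"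
      by (intro mult_left_mono) auto
    also have "\<dots> = (6 * real l * 2 powr a) * (X * (real k)\<^sup>2)" by simp
    also have "\<dots> \<le> L * (X * (real k)\<^sup>2)"
      using that(2) X by (intro mult_right_mono) auto
    finally have "real (6 * l * k\<^sup>2 * 2 ^ m) \<le> real n" by (simp add: n mult_ac)
    then show ?thesis by (simp only: of_nat_le_iff)
  qed
  have "1 / 20000 * (x * L) \<le> c" if c: "competitive n k c D" for c
  proof -
    have c1: "1 \<le> c" by (rule competitive_ge_1[OF D k(2) c])
    \<comment> \<open>For \<open>64 <= L\<close>, \<open>L / 32 - 1 >= L / 64\<close> lets
      \<open>l\<close> be of order \<open>L\<close>. For bounded \<open>L\<close> a single bit is
      enough, and if \<open>x\<close> is bounded as well, \<open>1 <= c\<close> absorbs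
      \<open>x * L <= 512\<close>. The constant 20000 exceeds \<open>104 * 64\<close> and
      \<open>104 * 128\<close>, the losses in the cases that use gadgets.\<close>
    consider "x \<le> 0" | "0 < x" "64 \<le> L" | "0 < x" "x < 8" "L < 64" | "8 \<le> x" "L < 64" by linarith
    then show ?thesis
    proof cases
      case 1
      then have "x * L \<le> 0" using L by (intro mult_nonpos_nonneg) auto
      then show ?thesis using c1 by linarith
    next
      case 2
      \<comment> \<open>A small fraction of \<open>log k\<close> leaves room for the constant factor in the number of nodes,
        even when \<open>X\<close> is close to 1.\<close>
      define l where "l = nat \<lfloor>L / 32\<rfloor>"
      define m where "m = nat \<lfloor>x\<rfloor> + 2"
      have l: "real l \<le> L / 32" "L / 32 - 1 < real l"
        unfolding l_def using 2 by linarith+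
      then have l64: "L / 64 \<le> real l" "1 \<le> l" using 2 by linarith+
      have m: "real m \<le> x + 2" "x \<le> real m" unfolding m_def using 2 by linarith+
      have "real (3 * 2 ^ l) \<le> 2 powr 2 * 2 powr real l"
        by (simp add: powr_realpow)
      also have "\<dots> = 2 powr (2 + real l)" by (rule powr_add[symmetric])
      also have "\<dots> \<le> 2 powr L" using l 2 by (intro powr_mono) linarith+
      finally have "3 * 2 ^ l \<le> k" unfolding k_powr[symmetric] by (simp only: of_nat_le_iff)
      moreover have "6 * l * k\<^sup>2 * 2 ^ m \<le> n"
        using l(1) L by (intro nodes[OF m(1)]) simp
      ultimately have "real (m * l) / 104 \<le> c"
        using l64 by (intro competitive_ge_levels[OF D k c]) (auto simp: m_def)
      moreover have "x * (L / 64) \<le> real m * real l"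
        using m(2) l64(1) 2 by (intro mult_mono) auto
      moreover have "0 \<le> x * L" using 2 by simp
      ultimately show ?thesis by simp
    next
      case 3
      then have "x * L \<le> 8 * 64" using L by (intro mult_mono) auto
      then show ?thesis using c1 by linarith
    next
      case 4
      \<comment> \<open>Subtracting 3 pays for the factor 6, as \<open>6 / 2 ^ 3 <= 1 <= L\<close>;
        and \<open>8 <= x\<close> gives \<open>x - 4 >= x / 2\<close>.\<close>
      define m where "m = nat \<lfloor>x\<rfloor> - 3"
      have m: "real m \<le> x + - 3" "x / 2 \<le> real m" "1 \<le> m" unfolding m_def using 4 by linarith+
      have "6 * 1 * k\<^sup>2 * 2 ^ m \<le> n"
        using L by (intro nodes[OF m(1)]) (simp add: powr_minus)
      then have "real (m * 1) / 104 \<le> c"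
        using m(3) by (intro competitive_ge_levels[OF D k c]) auto
      then have "real m \<le> 104 * c" by simp
      moreover have "x * L \<le> x * 64" using 4 by (intro mult_left_mono) auto
      ultimately show ?thesis using m(2) c1 by linarith
    qed
  qed
  then show "ereal (1 / 20000 * (log 2 (real n / ((real k)\<^sup>2 * log 2 (real k))) * log 2 (real k)))
      \<le> competitive_ratio n k D"
    unfolding competitive_ratio_def x_def X_def L_def by (intro INF_greatest) simp
qed simp

end
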